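(* In the setting of the context, let $\boldsymbol{z}\sim\mathcal{N}(\boldsymbol{0},C(\alpha))$, $\boldsymbol{x}=\boldsymbol{x}^*(\alpha)+\boldsymbol{z}$, $V_{\mathrm{fluc}}=\frac{\boldsymbol{z}^\top P\boldsymbol{z}}{N-1}$ and $V=\frac{\|P\boldsymbol{x}\|^2}{N-1}$. Then the variance of the random variable $V_{\mathrm{fluc}}$ is $$\operatorname{Var}[V_{\mathrm{fluc}}]=\frac{2\operatorname{Tr}(PCPC)}{(N-1)^2}.$$ If $\sigma_{\mathrm{eff,c}}^2=\boldsymbol{w}_{\mathrm c}^\top BB^\top\boldsymbol{w}_{\mathrm c}>0$ and $\rho_{\mathrm c}=(\boldsymbol{1}^\top\boldsymbol{v}_{\mathrm c})^2/N<1$, then, as $\alpha\to\alpha_{\mathrm c}^-$, $$\frac{\operatorname{sd}[V_{\mathrm{fluc}}]}{\mathbb{E}[V_{\mathrm{fluc}}]}\longrightarrow\sqrt2,$$ and the same limit holds for the full spatial variance: $\operatorname{sd}[V]/\mathbb{E}[V]\longrightarrow\sqrt2$.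
   Context: Setting. $N\ge2$. Consider the It\^o SDE $\mathrm d\boldsymbol{x}=F(\boldsymbol{x};\alpha)\,\mathrm dt+B\,\mathrm d\boldsymbol{W}$ in $\mathbb{R}^N$, with $B\in\mathbb{R}^{N\times m}$ constant, $\boldsymbol{W}$ an $m$-dimensional standard Wiener process, and $F$ sufficiently smooth in $(\boldsymbol{x},\alpha)$ ($C^2$ in a neighborhood of the equilibrium branch, including its endpoint at $\alpha_{\mathrm c}$, suffices). $\boldsymbol{x}^*(\alpha)$ is a branch of equilibria, $F(\boldsymbol{x}^*(\alpha);\alpha)=\boldsymbol{0}$, asymptotically stable for $\alpha<\alpha_{\mathrm c}$, and $M(\alpha)=-\frac{\partial F}{\partial\boldsymbol{x}}\big|_{\boldsymbol{x}=\boldsymbol{x}^*(\alpha)}$. $C=C(\alpha)$ is the stationary covariance of the linearized process $\mathrm d\boldsymbol{z}=-M\boldsymbol{z}\,\mathrm dt+B\,\mathrm d\boldsymbol{W}$, i.e. the solution of $MC+CM^\top=BB^\top$. Regular simple real critical eigenvalue assumption (in force). As $\alpha\to\alpha_{\mathrm c}^-$, $\boldsymbol{x}^*(\alpha)$ has a finite limit. For $\alpha<\alpha_{\mathrm c}$ close to $\alpha_{\mathrm c}$, $M(\alpha)$ is diagonalizable over $\mathbb{C}$ with all eigenvalues of positive real part; the eigenvalue $\lambda_1(\alpha)$ of smallest real part is real and simple, $\lambda_1(\alpha)>0$, $\lambda_1(\alpha)\to0$, and $\operatorname{Re}\lambda_k(\alpha)\ge\delta>0$ for $k=2,\dots,N$,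 with $\delta$ independent of $\alpha$. Real right and left eigenvectors $\boldsymbol{v}(\alpha),\boldsymbol{w}(\alpha)$ are chosen with $M\boldsymbol{v}=\lambda_1\boldsymbol{v}$, $\boldsymbol{w}^\top M=\lambda_1\boldsymbol{w}^\top$, $\|\boldsymbol{v}\|_2=1$, $\boldsymbol{w}^\top\boldsymbol{v}=1$, and they have finite limits $\boldsymbol{v}_{\mathrm c},\boldsymbol{w}_{\mathrm c}$ as $\alpha\to\alpha_{\mathrm c}^-$. Notation: $P=I-\frac1N\boldsymbol{1}\boldsymbol{1}^\top$; $\operatorname{Var}[\cdot]$ and $\operatorname{sd}[\cdot]$ of a random variable are its probabilistic variance and standard deviation over the law of $\boldsymbol{z}$. $V$ is the sample variance of the components of $\boldsymbol{x}$. *)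

theory Defs
  imports "HOL-Probability.Probability" "HOL-Computational_Algebra.Polynomial"
begin

section \<open>Equilibria of ODEs and smoothness\<close>

definition C2_on :: "('a::real_normed_vector \<Rightarrow> 'b::real_normed_vector) \<Rightarrow> 'a set \<Rightarrow> bool" where
  "C2_on f U \<longleftrightarrow> open U \<and>
     (\<exists>(f' :: 'a \<Rightarrow> 'a \<Rightarrow>\<^sub>L 'b) (f'' :: 'a \<Rightarrow> 'a \<Rightarrow>\<^sub>L ('a \<Rightarrow>\<^sub>L 'b)).
        (\<forall>p\<in>U. (f has_derivative blinfun_apply (f' p)) (at p)) \<and>
        (\<forall>p\<in>U. (f' has_derivative blinfun_apply (f'' p)) (at p)) \<and>
        continuous_on U f'')"

definition solves_ode :: "('a::real_normed_vector \<Rightarrow> 'a) \<Rightarrow> real set \<Rightarrow> (real \<Rightarrow> 'a) \<Rightarrow> bool" where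
  "solves_ode f T u \<longleftrightarrow> (\<forall>t\<in>T. (u has_vector_derivative f (u t)) (at t within T))"

definition Lyapunov_stable :: "('a::real_normed_vector \<Rightarrow> 'a) \<Rightarrow> 'a \<Rightarrow> bool" where
  "Lyapunov_stable f p \<longleftrightarrow>
     (\<forall>\<epsilon>>0. \<exists>d>0. \<forall>u. \<forall>\<tau>\<ge>0. solves_ode f {0..\<tau>} u \<and> dist (u 0) p < d
        \<longrightarrow> (\<forall>t\<in>{0..\<tau>}. dist (u t) p < \<epsilon>))"

definition asymptotically_stable :: "('a::real_normed_vector \<Rightarrow> 'a) \<Rightarrow> 'a \<Rightarrow> bool" where
  "asymptotically_stable f p \<longleftrightarrow> Lyapunov_stable f p \<and>
     (\<exists>d>0. \<forall>u. solves_ode f {0..} u \<and> dist (u 0) p < d \<longrightarrow> (u \<longlongrightarrow> p) at_top)"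

definition linearization ::
  "(real^'n \<Rightarrow> real \<Rightarrow> real^'n) \<Rightarrow> (real \<Rightarrow> real^'n) \<Rightarrow> real \<Rightarrow> real^'n^'n" where
  "linearization F xs \<alpha> = - jacobian (\<lambda>x. F x \<alpha>) (at (xs \<alpha>))"


section \<open>Spectral notions\<close>

definition charpoly :: "'a::comm_ring_1^'n^'n \<Rightarrow> 'a poly" where
  "charpoly A = det (\<chi> i j. (if i = j then [:0, 1:] else 0) - [:A $ i $ j:])"

definition complex_matrix :: "real^'n^'m \<Rightarrow> complex^'n^'m" where
  "complex_matrix A = (\<chi> i j. complex_of_real (A $ i $ j))"

definition is_eigenvalue :: "real^'n^'n \<Rightarrow> complex \<Rightarrow> bool" where
  "is_eigenvalue A \<mu> \<longleftrightarrow> (\<exists>u. u \<noteq> 0 \<and> complex_matrix A *v u = \<mu> *s u)"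

definition simple_eigenvalue :: "real^'n^'n \<Rightarrow> complex \<Rightarrow> bool" where
  "simple_eigenvalue A \<mu> \<longleftrightarrow> is_eigenvalue A \<mu> \<and> order \<mu> (charpoly (complex_matrix A)) = 1"

definition complex_diagonalizable :: "real^'n^'n \<Rightarrow> bool" where
  "complex_diagonalizable A \<longleftrightarrow>
     (\<exists>(S :: complex^'n^'n) (D :: complex^'n^'n). invertible S \<and> (\<forall>i j. i \<noteq> j \<longrightarrow> D $ i $ j = 0) \<and>
        complex_matrix A = S ** D ** matrix_inv S)"

text \<open>
  The regular simple real critical eigenvalue assumption for a matrix family \<open>M\<close> as
  \<open>\<alpha> \<rightarrow> \<alpha>\<^sub>c\<close> from the left. Since \<open>lam\<^sub>1\<close> is simple, the eigenvalues
  \<open>\<lambda>\<^sub>2, \<dots>, \<lambda>\<^sub>N\<close> listed with multiplicity are exactly those different from \<open>lam\<^sub>1\<close>.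
\<close>

definition regular_critical_eigenvalue ::
  "(real \<Rightarrow> real^'n^'n) \<Rightarrow> real \<Rightarrow> (real \<Rightarrow> real) \<Rightarrow> (real \<Rightarrow> real^'n) \<Rightarrow> (real \<Rightarrow> real^'n)
     \<Rightarrow> real^'n \<Rightarrow> real^'n \<Rightarrow> bool" where
  "regular_critical_eigenvalue M \<alpha>\<^sub>c lam\<^sub>1 v w v\<^sub>c w\<^sub>c \<longleftrightarrow>
     (\<forall>\<^sub>F \<alpha> in at_left \<alpha>\<^sub>c.
        complex_diagonalizable (M \<alpha>) \<and>
        (\<forall>\<mu>. is_eigenvalue (M \<alpha>) \<mu> \<longrightarrow> 0 < Re \<mu> \<and> lam\<^sub>1 \<alpha> \<le> Re \<mu>) \<and>
        simple_eigenvalue (M \<alpha>) (complex_of_real (lam\<^sub>1 \<alpha>)) \<and>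
        0 < lam\<^sub>1 \<alpha>) \<and>
     (lam\<^sub>1 \<longlongrightarrow> 0) (at_left \<alpha>\<^sub>c) \<and>
     (\<exists>\<delta>>0. \<forall>\<^sub>F \<alpha> in at_left \<alpha>\<^sub>c.
        \<forall>\<mu>. is_eigenvalue (M \<alpha>) \<mu> \<and> \<mu> \<noteq> complex_of_real (lam\<^sub>1 \<alpha>) \<longrightarrow> \<delta> \<le> Re \<mu>) \<and>
     (\<forall>\<^sub>F \<alpha> in at_left \<alpha>\<^sub>c.
        M \<alpha> *v v \<alpha> = lam\<^sub>1 \<alpha> *\<^sub>R v \<alpha> \<and> w \<alpha> v* M \<alpha> = lam\<^sub>1 \<alpha> *\<^sub>R w \<alpha> \<and>
        norm (v \<alpha>) = 1 \<and> w \<alpha> \<bullet> v \<alpha> = 1) \<and>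
     (v \<longlongrightarrow> v\<^sub>c) (at_left \<alpha>\<^sub>c) \<and> (w \<longlongrightarrow> w\<^sub>c) (at_left \<alpha>\<^sub>c)"


section \<open>Gaussian vectors\<close>

text \<open>The stationary covariance of \<open>dz = - M z dt + B dW\<close>, as a solution of the Lyapunov equation.\<close>

definition stationary_covariance :: "real^'n^'n \<Rightarrow> real^'m^'n \<Rightarrow> real^'n^'n \<Rightarrow> bool" where
  "stationary_covariance M B C \<longleftrightarrow> M ** C + C ** transpose M = B ** transpose B"

text \<open>
  Normal laws with possibly vanishing variance: the covariance matrix may be singular because
  \<open>B\<close> need not have full rank.
\<close>

definition normal_rv :: "'a measure \<Rightarrow> ('a \<Rightarrow> real) \<Rightarrow> real \<Rightarrow> real \<Rightarrow> bool" where
  "normal_rv \<Omega> Y \<mu> s2 \<longleftrightarrow>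
     (if 0 < s2 then distributed \<Omega> lborel Y (normal_density \<mu> (sqrt s2))
      else s2 = 0 \<and> Y \<in> borel_measurable \<Omega> \<and> (AE \<omega> in \<Omega>. Y \<omega> = \<mu>))"

text \<open>
  \<open>X \<sim> N(\<mu>, C)\<close>: every linear functional of \<open>X\<close> is normal. Positive semidefiniteness of \<open>C\<close>
  is part of this, as \<open>normal_rv\<close> excludes negative variances.
\<close>

definition multivariate_normal ::
  "'a measure \<Rightarrow> ('a \<Rightarrow> real^'n) \<Rightarrow> real^'n \<Rightarrow> real^'n^'n \<Rightarrow> bool" where
  "multivariate_normal \<Omega> X \<mu> C \<longleftrightarrow>
     X \<in> borel_measurable \<Omega> \<and> transpose C = C \<and>
     (\<forall>a. normal_rv \<Omega> (\<lambda>\<omega>. a \<bullet> X \<omega>) (a \<bullet> \<mu>) (a \<bullet> (C *v a)))"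

definition sd :: "'a measure \<Rightarrow> ('a \<Rightarrow> real) \<Rightarrow> real" where
  "sd \<Omega> Y = sqrt (prob_space.variance \<Omega> Y)"


section \<open>Spatial variance\<close>

definition centering :: "real^'n^'n" where
  "centering = mat 1 - (1 / real CARD('n)) *\<^sub>R (\<chi> i j. 1)"

definition V_fluc :: "real^'n \<Rightarrow> real" where
  "V_fluc z = (z \<bullet> (centering *v z)) / (real CARD('n) - 1)"

definition spatial_variance :: "real^'n \<Rightarrow> real" where
  "spatial_variance x = (norm (centering *v x))\<^sup>2 / (real CARD('n) - 1)"

end

theory Submission
  imports Defs
begin

text \<open>
  The moments of a Gaussian vector up to order four follow by polarization from those of its linear
  functionals. Hence, for \<open>x = m + z\<close>, the spatial variance has mean \<open>(|P m|\<^sup>2 + Tr (P C P)) / (N - 1)\<close>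
  and variance \<open>(4 (P m) \<bullet> C (P m) + 2 Tr (P C P C)) / (N - 1)\<^sup>2\<close>; the fluctuation part is the case
  \<open>m = 0\<close>. After rescaling \<open>C\<close> by \<open>\<lambda>\<^sub>1 \<rightarrow> 0\<close> the contribution of \<open>m\<close> disappears, so it suffices that
  \<open>\<lambda>\<^sub>1 C\<close> converges to \<open>s v\<^sub>c v\<^sub>c\<^sup>T\<close> with \<open>s = \<sigma>\<^sub>e\<^sub>f\<^sub>f\<^sub>,\<^sub>c\<^sup>2 / 2\<close>: on a rank one limit the ratio is exactly
  \<open>\<surd>2\<close>.

  For this limit the critical eigenvalue is shifted away: \<open>A = M + \<delta> v w\<^sup>T\<close> has all eigenvalues of real
  part at least \<open>\<delta>\<close>, so the determinant of the Sylvester operator \<open>X \<mapsto> A X + X A\<^sup>T\<close>, which is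
  \<open>\<Prod>\<^sub>i\<^sub>j (\<mu>\<^sub>i + \<mu>\<^sub>j)\<close>, stays bounded away from zero. The limiting operator is therefore injective, although
  the limit of \<open>M\<close> need not be diagonalizable. The Lyapunov equation, applied to \<open>w\<close>, first yields
  \<open>\<lambda>\<^sub>1 C w \<rightarrow> s v\<^sub>c\<close>, and then \<open>A (\<lambda>\<^sub>1 C) + (\<lambda>\<^sub>1 C) A\<^sup>T\<close> converges to the image of \<open>s v\<^sub>c v\<^sub>c\<^sup>T\<close>.
\<close>

section \<open>Convergence of preimages under convergent linear operators\<close>

text \<open>In finite dimension an injective limit is bounded below, and pointwise convergence is
  uniform on the unit ball. Hence the operators \<open>L t\<close> eventually share a lower bound,
  and convergence of the images forces convergence of the arguments.\<close>

lemma tendsto_of_tendsto_linear_image: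
  fixes L :: "'t \<Rightarrow> 'a::euclidean_space \<Rightarrow> 'b::euclidean_space"
  assumes lin: "\<And>t. linear (L t)" and lin_c: "linear L\<^sub>c" and inj_c: "inj L\<^sub>c"
    and lim: "\<And>x. ((\<lambda>t. L t x) \<longlongrightarrow> L\<^sub>c x) G"
    and image: "((\<lambda>t. L t (x t)) \<longlongrightarrow> L\<^sub>c y) G"
  shows "(x \<longlongrightarrow> y) G"
proof -
  obtain m where m: "m > 0" "\<And>x. m * norm x \<le> norm (L\<^sub>c x)"
    using linear_inj_bounded_below_pos[OF lin_c inj_c] by blast
  \<comment> \<open>A finite sum over the basis, hence null; it dominates the operator norm of
    \<open>L\<^sub>c - L t\<close>.\<close>
  define e where "e t = (\<Sum>b\<in>Basis. norm (L\<^sub>c b - L t b))" for t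
  have "((\<lambda>t. L\<^sub>c b - L t b) \<longlongrightarrow> 0) G" for b
    using tendsto_diff[OF tendsto_const lim, of "L\<^sub>c b" b] by simp
  then have e_lim: "(e \<longlongrightarrow> 0) G"
    unfolding e_def by (intro tendsto_null_sum tendsto_norm_zero)
  have e_bound: "norm (L\<^sub>c u - L t u) \<le> e t * norm u" for t u
  proof -
    have "linear (\<lambda>u. L\<^sub>c u - L t u)"
      using lin lin_c by (intro linear_compose_sub)
    then have "L\<^sub>c u - L t u = (\<Sum>b\<in>Basis. (u \<bullet> b) *\<^sub>R (L\<^sub>c b - L t b))"
      using linear_sum[of "\<lambda>u. L\<^sub>c u - L t u" "\<lambda>b. (u \<bullet> b) *\<^sub>R b" Basis]
      by (simp add: euclidean_representation linear_scale[of "\<lambda>u. L\<^sub>c u - L t u"])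
    also have "norm \<dots> \<le> (\<Sum>b\<in>Basis. norm u * norm (L\<^sub>c b - L t b))"
      by (intro sum_norm_le) (auto intro!: mult_right_mono Basis_le_norm)
    finally show ?thesis by (simp add: e_def sum_distrib_left mult.commute)
  qed
  have "((\<lambda>t. L t (x t) - L t y) \<longlongrightarrow> 0) G"
    using tendsto_diff[OF image lim[of y]] by simp
  then have lim0: "((\<lambda>t. norm (L t (x t - y)) * (2 / m)) \<longlongrightarrow> 0) G"
    using lin by (auto simp: linear_diff divide_inverse mult.assoc intro!: tendsto_mult_left_zero tendsto_norm_zero)
  \<comment> \<open>Half of the lower bound \<open>m\<close> then survives for
    \<open>L t\<close>.\<close>
  have "\<forall>\<^sub>F t in G. e t < m / 2"
    using e_lim m(1) by (intro order_tendstoD) auto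
  then have "\<forall>\<^sub>F t in G. norm (x t - y) \<le> norm (L t (x t - y)) * (2 / m)"
  proof eventually_elim
    case (elim t)
    let ?u = "x t - y"
    have "m * norm ?u \<le> norm (L t ?u) + norm (L\<^sub>c ?u - L t ?u)"
      using m(2)[of ?u] norm_triangle_ineq[of "L t ?u" "L\<^sub>c ?u - L t ?u"] by simp
    also have "\<dots> \<le> norm (L t ?u) + m / 2 * norm ?u"
      using e_bound[of ?u t] mult_right_mono[OF less_imp_le[OF elim], of "norm ?u"] by simp
    finally show ?case using m(1) by (simp add: field_simps)
  qed
  then have "((\<lambda>t. x t - y) \<longlongrightarrow> 0) G"
    by (rule Lim_null_comparison[OF _ lim0])
  then show ?thesis by (simp add: LIM_zero_iff)
qed

section \<open>Sylvester operators\<close>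

definition outer :: "'a::times^'n \<Rightarrow> 'a^'m \<Rightarrow> 'a^'m^'n" where
  "outer u v = (\<chi> i j. u $ i * v $ j)"

text \<open>The matrix of \<open>X \<mapsto> A X + X A\<^sup>T\<close> for \<open>X\<close> flattened to a vector indexed by pairs.\<close>

definition sylvester_matrix :: "'a::comm_ring_1^'n^'n \<Rightarrow> 'a^('n \<times> 'n)^('n \<times> 'n)" where
  "sylvester_matrix A = (\<chi> p q. A $ fst p $ fst q * (if snd p = snd q then 1 else 0)
     + (if fst p = fst q then 1 else 0) * A $ snd p $ snd q)"

lemma sum_UNIV_prod: "(\<Sum>p\<in>UNIV. f p) = (\<Sum>i\<in>UNIV. \<Sum>j\<in>UNIV. f (i, j))"
  by (simp add: sum.cartesian_product)

text \<open>Each Kronecker delta collapses one of the two sums. With \<open>a\<close> and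
  \<open>b\<close> the rows \<open>i\<close> and \<open>j\<close> of a matrix, the left side is row
  \<open>(i, j)\<close> of its Sylvester matrix applied to \<open>f\<close>.\<close>

lemma sum_kronecker:
  fixes f :: "'n::finite \<Rightarrow> 'n \<Rightarrow> 'a::comm_ring_1"
  shows "(\<Sum>k\<in>UNIV. \<Sum>l\<in>UNIV. (a k * (if j = l then 1 else 0) + (if i = k then 1 else 0) * b l) * f k l)
    = (\<Sum>k\<in>UNIV. a k * f k j) + (\<Sum>l\<in>UNIV. b l * f i l)"
proof -
  have "(\<Sum>k\<in>UNIV. \<Sum>l\<in>UNIV. (if i = k then 1 else 0) * b l * f k l) = (\<Sum>l\<in>UNIV. b l * f i l)"
    by (subst sum.swap) (simp add: if_distrib[of "\<lambda>x. x * _"] if_distrib[of "\<lambda>x. _ * x"] cong: if_cong)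
  moreover have "(\<Sum>k\<in>UNIV. \<Sum>l\<in>UNIV. a k * (if j = l then 1 else 0) * f k l) = (\<Sum>k\<in>UNIV. a k * f k j)"
    by (simp add: if_distrib[of "\<lambda>x. x * _"] if_distrib[of "\<lambda>x. _ * x"] cong: if_cong)
  ultimately show ?thesis
    by (simp only: distrib_right sum.distrib)
qed

lemma sylvester_matrix_mult_vec:
  fixes A :: "'a::comm_ring_1^'n^'n"
  shows "sylvester_matrix A *v (\<chi> p. Y $ fst p $ snd p) = (\<chi> p. (A ** Y + Y ** transpose A) $ fst p $ snd p)"
proof -
  have "(\<Sum>k\<in>UNIV. \<Sum>l\<in>UNIV. (A $ i $ k * (if j = l then 1 else 0) + (if i = k then 1 else 0) * A $ j $ l) * Y $ k $ l)
    = (\<Sum>k\<in>UNIV. A $ i $ k * Y $ k $ j) + (\<Sum>l\<in>UNIV. A $ j $ l * Y $ i $ l)" for i j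
    using sum_kronecker[where f = "\<lambda>k l. Y $ k $ l"] by simp
  then show ?thesis
    by (simp add: vec_eq_iff sylvester_matrix_def matrix_vector_mult_def matrix_matrix_mult_def
      transpose_def sum_UNIV_prod mult.commute[of "Y $ _ $ _"])
qed

lemma matrix_mult_diagonal:
  fixes S D :: "'a::semiring_1^'n^'n"
  assumes "\<And>i j. i \<noteq> j \<Longrightarrow> D $ i $ j = 0"
  shows "(S ** D) $ i $ j = S $ i $ j * D $ j $ j"
  unfolding matrix_matrix_mult_def
  by (simp, subst sum.remove[of _ j]) (auto intro!: sum.neutral simp: assms)

text \<open>If \<open>x\<close> and \<open>y\<close> are eigenvectors of \<open>A\<close>, then
  \<open>outer x y\<close> is an eigenvector of the Sylvester operator, and its eigenvalue is the
  sum of theirs. The columns of \<open>S\<close> thus provide a full eigenbasis.\<close>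

lemma det_sylvester_matrix:
  fixes A S D :: "'a::field^'n^'n"
  assumes AS: "A ** S = S ** D" and S: "invertible S" and D: "\<And>i j. i \<noteq> j \<Longrightarrow> D $ i $ j = 0"
  shows "det (sylvester_matrix A) = (\<Prod>p\<in>UNIV. D $ fst p $ fst p + D $ snd p $ snd p)"
proof -
  obtain S' where S': "S ** S' = mat 1" using S unfolding invertible_def by blast
  \<comment> \<open>\<open>T R\<close> is the Kronecker square of \<open>R\<close>, so \<open>T S\<close> diagonalizes the Sylvester matrix\<close>
  define T where "T R = (\<chi> p q. R $ fst p $ fst q * R $ snd p $ snd q)" for R :: "'a^'n^'n"
  define \<Delta> :: "'a^('n \<times> 'n)^('n \<times> 'n)"
    where "\<Delta> = (\<chi> p q. if p = q then D $ fst p $ fst p + D $ snd p $ snd p else 0)"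
  have AS': "(\<Sum>k\<in>UNIV. A $ i $ k * S $ k $ j) = S $ i $ j * D $ j $ j" for i j
    using arg_cong[OF AS, of "\<lambda>X. X $ i $ j"] matrix_mult_diagonal[OF D, of S i j] by (simp add: matrix_matrix_mult_def)
  have T_mult: "T R ** T R' = T (R ** R')" for R R'
    by (simp add: vec_eq_iff T_def matrix_matrix_mult_def sum_UNIV_prod sum_product mult_ac)
  have "T S ** T S' = mat 1"
    unfolding T_mult S' by (auto simp: T_def mat_def vec_eq_iff prod_eq_iff)
  then have "det (T S) \<noteq> 0"
    using det_mul[of "T S" "T S'"] by auto
  moreover have "sylvester_matrix A ** T S = T S ** \<Delta>"
  proof -
    have "(sylvester_matrix A ** T S) $ p $ q = 
       (\<Sum>k\<in>UNIV. A $ fst p $ k * S $ k $ fst q) * S $ snd p $ snd q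
       + S $ fst p $ fst q * (\<Sum>l\<in>UNIV. A $ snd p $ l * S $ l $ snd q)" for p q
      using sum_kronecker[of "\<lambda>k. A $ fst p $ k" "snd p" "fst p" "\<lambda>l. A $ snd p $ l"
          "\<lambda>k l. S $ k $ fst q * S $ l $ snd q"]
      by (simp add: sylvester_matrix_def T_def matrix_matrix_mult_def sum_UNIV_prod
          sum_distrib_left sum_distrib_right mult.assoc mult.left_commute)
    moreover have "(T S ** \<Delta>) $ p $ q = T S $ p $ q * (D $ fst q $ fst q + D $ snd q $ snd q)" for p q
      unfolding matrix_matrix_mult_def \<Delta>_def
      by (simp add: if_distrib[of "\<lambda>x. _ * x"] cong: if_cong)
    ultimately show ?thesis
      by (simp add: vec_eq_iff AS' T_def algebra_simps)
  qed
  then have "det (sylvester_matrix A) * det (T S) = det (T S) * det \<Delta>"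
    using det_mul by metis
  moreover have "det \<Delta> = (\<Prod>p\<in>UNIV. D $ fst p $ fst p + D $ snd p $ snd p)"
    by (subst det_diagonal) (auto simp: \<Delta>_def)
  ultimately show ?thesis by simp
qed

lemma diagonal_matrix_vector_mult:
  fixes D :: "'a::semiring_1^'n^'n"
  assumes "\<And>i j. i \<noteq> j \<Longrightarrow> D $ i $ j = 0"
  shows "(D *v u) $ i = D $ i $ i * u $ i"
  unfolding matrix_vector_mult_def
  by (simp, subst sum.remove[of _ i]) (auto intro!: sum.neutral simp: assms)

section \<open>Diagonalization with a shifted critical eigenvalue\<close>

text \<open>Evaluation at \<open>t\<close> is a ring homomorphism, so it passes through the Leibniz
  expansion.\<close>

lemma poly_charpoly:
  fixes A :: "'a::comm_ring_1^'n^'n"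
  shows "poly (charpoly A) t = det (mat t - A)"
  unfolding charpoly_def det_def
  by (auto simp: poly_sum poly_prod mat_def of_int_poly[symmetric] intro!: sum.cong prod.cong arg_cong2[of _ _ _ _ "(*)"])

text \<open>Similarity gives equal values at every point, and a complex polynomial is determined by
  its values. This lets algebraic multiplicity be read off the diagonal of \<open>D\<close>.\<close>

lemma charpoly_diagonalized:
  fixes A S D :: "complex^'n^'n"
  assumes AS: "A ** S = S ** D" and S: "invertible S" and D: "\<And>i j. i \<noteq> j \<Longrightarrow> D $ i $ j = 0"
  shows "charpoly A = (\<Prod>i\<in>UNIV. [:- D $ i $ i, 1:])"
proof -
  have "poly (charpoly A) t = poly (\<Prod>i\<in>UNIV. [:- D $ i $ i, 1:]) t" for t
  proof -
    have "(mat t - A) ** S = S ** (mat t - D)"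
    proof -
      have "((mat t - A) ** S) $ i $ j = t * S $ i $ j - (A ** S) $ i $ j" for i j
        by (simp add: matrix_matrix_mult_def mat_def left_diff_distrib sum_subtractf
            if_distrib[of "\<lambda>x. x * _"] cong: if_cong)
      moreover have "(S ** (mat t - D)) $ i $ j = S $ i $ j * (t - D $ j $ j)" for i j
        by (subst matrix_mult_diagonal) (auto simp: D mat_def)
      ultimately show ?thesis
        by (simp add: vec_eq_iff AS matrix_mult_diagonal[OF D] right_diff_distrib mult.commute[of t])
    qed
    then have "det (mat t - A) * det S = det S * det (mat t - D)"
      using det_mul by metis
    moreover have "det S \<noteq> 0" using S by (simp add: invertible_det_nz)
    moreover have "det (mat t - D) = (\<Prod>i\<in>UNIV. t - D $ i $ i)"
      by (subst det_diagonal) (auto simp: mat_def D)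
    ultimately show ?thesis
      by (simp add: poly_charpoly poly_prod)
  qed
  then show ?thesis by (intro poly_ext) auto
qed

lemma complex_matrix_mult_vec_of_real:
  "complex_matrix A *v (\<chi> i. complex_of_real (u $ i)) = (\<chi> i. complex_of_real ((A *v u) $ i))"
  by (simp add: complex_matrix_def matrix_vector_mult_def vec_eq_iff)

text \<open>In the eigenbasis \<open>S\<close>, both \<open>v\<close> and \<open>w\<close> are
  supported on the single index \<open>k\<close> carrying the simple eigenvalue. The rank one shift
  therefore keeps \<open>S\<close> and only changes that diagonal entry from \<open>l\<close> to
  \<open>l + \<delta>\<close>; all other entries obey the gap.\<close>

lemma deflated_diagonalization:
  fixes M :: "real^'n^'n"
  assumes diag: "complex_diagonalizable M"
    and simple: "simple_eigenvalue M (complex_of_real l)"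
    and v: "M *v v = l *\<^sub>R v" and w: "w v* M = l *\<^sub>R w" and wv: "w \<bullet> v = 1"
    and gap: "\<And>\<mu>. is_eigenvalue M \<mu> \<Longrightarrow> \<mu> \<noteq> complex_of_real l \<Longrightarrow> \<delta> \<le> Re \<mu>"
    and nonneg: "0 \<le> l"
  obtains S D :: "complex^'n^'n"
  where "invertible S" "\<And>i j. i \<noteq> j \<Longrightarrow> D $ i $ j = 0"
    "complex_matrix (M + \<delta> *\<^sub>R outer v w) ** S = S ** D" "\<And>i. \<delta> \<le> Re (D $ i $ i)"
proof -
  let ?c = "complex_of_real l"
  obtain S D :: "complex^'n^'n" where S: "invertible S" and D: "\<And>i j. i \<noteq> j \<Longrightarrow> D $ i $ j = 0"
    and MSD: "complex_matrix M = S ** D ** matrix_inv S"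
    using diag unfolding complex_diagonalizable_def by blast
  have inv: "matrix_inv S ** S = mat 1" "S ** matrix_inv S = mat 1"
    using someI_ex[OF S[unfolded invertible_def]] by (simp_all add: matrix_inv_def)
  have MS: "complex_matrix M ** S = S ** D"
    by (simp add: MSD matrix_mul_assoc[symmetric] inv)
  have eig: "is_eigenvalue M (D $ i $ i)" for i
  proof -
    have "complex_matrix M *v column i S = D $ i $ i *s column i S"
      using matrix_mult_diagonal[OF D, of S _ i] unfolding MS[symmetric]
      by (simp add: vec_eq_iff column_def matrix_vector_mult_def matrix_matrix_mult_def mult.commute)
    moreover have "column i S \<noteq> 0"
    proof
      assume "column i S = 0"
      then have "det S = 0" by (rule det_zero_column)
      then show False using S by (simp add: invertible_det_nz)
    qed
    ultimately show ?thesis unfolding is_eigenvalue_def by blast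
  qed
  \<comment> \<open>Two diagonal entries equal to \<open>?c\<close> would make its order in the
    characteristic polynomial at least 2.\<close>
  have unique: "i = j" if "D $ i $ i = ?c" "D $ j $ j = ?c" for i j
  proof (rule ccontr)
    assume "i \<noteq> j"
    have "charpoly (complex_matrix M) = (\<Prod>k\<in>{i, j} \<union> (UNIV - {i, j}). [:- D $ k $ k, 1:])"
      by (simp add: charpoly_diagonalized[OF MS S D])
    also have "\<dots> = (\<Prod>k\<in>{i, j}. [:- D $ k $ k, 1:]) * (\<Prod>k\<in>UNIV - {i, j}. [:- D $ k $ k, 1:])"
      by (rule prod.union_disjoint) auto
    also have "(\<Prod>k\<in>{i, j}. [:- D $ k $ k, 1:]) = [:- ?c, 1:] ^ 2"
      using that \<open>i \<noteq> j\<close> by (simp add: power2_eq_square del: mult_pCons_left mult_pCons_right)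
    finally have "charpoly (complex_matrix M) = [:- ?c, 1:] ^ 2 * (\<Prod>k\<in>UNIV - {i, j}. [:- D $ k $ k, 1:])" .
    then have "[:- ?c, 1:] ^ 2 dvd charpoly (complex_matrix M)"
      by simp
    moreover have "charpoly (complex_matrix M) \<noteq> 0"
      by (auto simp: charpoly_diagonalized[OF MS S D])
    ultimately have "2 \<le> order ?c (charpoly (complex_matrix M))"
      by (simp add: order_divides)
    then show False using simple by (simp add: simple_eigenvalue_def)
  qed
  define vc wc :: "complex^'n" where "vc = (\<chi> i. complex_of_real (v $ i))" and "wc = (\<chi> i. complex_of_real (w $ i))"
  \<comment> \<open>\<open>u\<close> holds the coordinates of \<open>v\<close> in the columns of
    \<open>S\<close>, and \<open>g\<close> the pairings of \<open>w\<close> with those columns; both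
    are eigenvectors of \<open>D\<close>.\<close>
  define u where "u = matrix_inv S *v vc"
  define g where "g = wc v* S"
  have Su: "S *v u = vc"
    by (simp add: u_def matrix_vector_mul_assoc inv)
  have Mv: "complex_matrix M *v vc = ?c *s vc"
    by (simp add: vc_def complex_matrix_mult_vec_of_real v vec_eq_iff)
  have "D *v u = matrix_inv S *v (complex_matrix M *v vc)"
    by (simp add: u_def MSD matrix_vector_mul_assoc matrix_mul_assoc inv)
  then have "D *v u = ?c *s u"
    by (simp add: Mv u_def vector_scalar_commute)
  then have u0: "D $ i $ i = ?c" if "u $ i \<noteq> 0" for i
    using that diagonal_matrix_vector_mult[OF D, of u i] by simp
  have wM: "wc v* complex_matrix M = ?c *s wc"
  proof -
    have "(\<Sum>i\<in>UNIV. M $ i $ j * w $ i) = l * w $ j" for j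
      using arg_cong[OF w, of "\<lambda>x. x $ j"] by (simp add: vector_matrix_mult_def mult.commute)
    then have "(\<Sum>i\<in>UNIV. complex_of_real (M $ i $ j * w $ i)) = complex_of_real (l * w $ j)" for j
      unfolding of_real_sum[symmetric] by simp
    then show ?thesis
      by (simp add: vec_eq_iff wc_def complex_matrix_def vector_matrix_mult_def mult.commute)
  qed
  have "g v* D = ?c *s g"
  proof -
    have "g v* D = (wc v* complex_matrix M) v* S"
      by (simp add: g_def vector_matrix_mul_assoc MS)
    also have "\<dots> = ?c *s g"
      unfolding wM by (simp add: g_def vector_matrix_mult_def vec_eq_iff sum_distrib_left mult_ac)
    finally show ?thesis .
  qed
  moreover have "(g v* D) $ i = g $ i * D $ i $ i" for i
    unfolding vector_matrix_mult_def
    by (simp, subst sum.remove[of _ i]) (auto intro!: sum.neutral simp: D mult.commute)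
  ultimately have g0: "D $ i $ i = ?c" if "g $ i \<noteq> 0" for i
    using that by (metis mult.commute mult_cancel_left vector_smult_component)
  have gu: "(\<Sum>i\<in>UNIV. g $ i * u $ i) = 1"
  proof -
    have "(\<Sum>i\<in>UNIV. g $ i * u $ i) = (\<Sum>i\<in>UNIV. wc $ i * (S *v u) $ i)"
      unfolding g_def vector_matrix_mult_def matrix_vector_mult_def
      by (simp add: sum_distrib_left sum_distrib_right mult_ac, rule sum.swap)
    also have "\<dots> = complex_of_real (w \<bullet> v)"
      by (simp add: Su inner_vec_def vc_def wc_def)
    finally show ?thesis by (simp add: wv)
  qed
  \<comment> \<open>The normalization \<open>w \<bullet> v = 1\<close> guarantees an index at which
    both are nonzero; uniqueness of the critical entry then kills all other coordinates.\<close>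
  obtain k where k: "g $ k * u $ k \<noteq> 0"
    using gu by (metis (no_types, lifting) sum.neutral zero_neq_one)
  then have Dk: "D $ k $ k = ?c" using u0 by simp
  have zero: "u $ i = 0 \<and> g $ i = 0" if "i \<noteq> k" for i
    using that unique[OF _ Dk, of i] u0 g0 by blast
  have gu1: "u $ k * g $ k = 1"
    using gu by (subst (asm) sum.remove[of _ k]) (auto simp: zero mult.commute)
  \<comment> \<open>Since \<open>vc $ i = S $ i $ k * u $ k\<close> and
    \<open>u $ k * g $ k = 1\<close>, multiplying \<open>outer v w\<close> by \<open>S\<close>
    leaves just column \<open>k\<close> of \<open>S\<close>.\<close>
  define E where "E = (\<chi> i j. D $ i $ j + (if i = k \<and> j = k then complex_of_real \<delta> else 0))"
  have E0: "E $ i $ j = 0" if "i \<noteq> j" for i j using that D by (auto simp: E_def)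
  have vcS: "vc $ i = S $ i $ k * u $ k" for i
    unfolding Su[symmetric] matrix_vector_mult_def
    by (simp, subst sum.remove[of _ k]) (auto simp: zero)
  have "(complex_matrix (M + \<delta> *\<^sub>R outer v w) ** S) $ i $ j = (S ** E) $ i $ j" for i j
  proof -
    have "(complex_matrix (M + \<delta> *\<^sub>R outer v w) ** S) $ i $ j
       = (complex_matrix M ** S) $ i $ j + complex_of_real \<delta> * (vc $ i * g $ j)"
    proof -
      have "complex_matrix (M + \<delta> *\<^sub>R outer v w) $ i $ k
          = complex_matrix M $ i $ k + complex_of_real \<delta> * (vc $ i * wc $ k)" for k
        by (simp add: complex_matrix_def outer_def vc_def wc_def)
      then show ?thesis
        by (simp add: matrix_matrix_mult_def g_def vector_matrix_mult_def ring_distribs sum.distrib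
            sum_distrib_left mult_ac)
    qed
    also have "\<dots> = S $ i $ j * D $ j $ j + complex_of_real \<delta> * (vc $ i * g $ j)"
      by (simp add: MS matrix_mult_diagonal[OF D])
    also have "\<dots> = S $ i $ j * E $ j $ j"
      using zero[of j] gu1 by (cases "j = k") (auto simp: vcS E_def algebra_simps)
    finally show ?thesis by (simp add: matrix_mult_diagonal[OF E0])
  qed
  then have "complex_matrix (M + \<delta> *\<^sub>R outer v w) ** S = S ** E"
    by (simp add: vec_eq_iff)
  moreover have "\<delta> \<le> Re (E $ i $ i)" for i
  proof (cases "i = k")
    case True
    then show ?thesis using nonneg by (simp add: E_def Dk)
  next
    case False
    then have "D $ i $ i \<noteq> ?c" using unique[OF _ Dk] by blast
    then show ?thesis using gap[OF eig, of i] False by (simp add: E_def)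
  qed
  ultimately show ?thesis using that S E0 by blast
qed

section \<open>Lyapunov equations near a simple critical eigenvalue\<close>

lemma tendsto_matrix_matrix_mult:
  fixes A :: "'t \<Rightarrow> real^'n^'m" and B :: "'t \<Rightarrow> real^'k^'n"
  assumes "(A \<longlongrightarrow> a) G" "(B \<longlongrightarrow> b) G"
  shows "((\<lambda>t. A t ** B t) \<longlongrightarrow> a ** b) G"
  unfolding matrix_matrix_mult_def using assms by (intro tendsto_intros)

lemma tendsto_matrix_vector_mult:
  fixes A :: "'t \<Rightarrow> real^'n^'m" and u :: "'t \<Rightarrow> real^'n"
  assumes "(A \<longlongrightarrow> a) G" "(u \<longlongrightarrow> b) G"
  shows "((\<lambda>t. A t *v u t) \<longlongrightarrow> a *v b) G"
  unfolding matrix_vector_mult_def using assms by (intro tendsto_intros)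

lemma tendsto_transpose:
  fixes A :: "'t \<Rightarrow> real^'n^'m"
  assumes "(A \<longlongrightarrow> a) G"
  shows "((\<lambda>t. transpose (A t)) \<longlongrightarrow> transpose a) G"
  unfolding transpose_def using assms by (intro tendsto_intros)

lemma tendsto_outer:
  fixes u :: "'t \<Rightarrow> real^'n" and v :: "'t \<Rightarrow> real^'m"
  assumes "(u \<longlongrightarrow> a) G" "(v \<longlongrightarrow> b) G"
  shows "((\<lambda>t. outer (u t) (v t)) \<longlongrightarrow> outer a b) G"
  unfolding outer_def using assms by (intro tendsto_intros)

lemma matrix_mult_outer: "A ** outer u v = outer (A *v u) v"
  for A :: "'a::comm_semiring_1^'n^'m"
  by (simp add: vec_eq_iff outer_def matrix_matrix_mult_def matrix_vector_mult_def sum_distrib_left mult_ac)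

lemma outer_mult_matrix: "outer u v ** A = outer u (v v* A)"
  for A :: "'a::comm_semiring_1^'n^'m"
  by (simp add: vec_eq_iff outer_def matrix_matrix_mult_def vector_matrix_mult_def sum_distrib_left mult_ac)

lemma outer_mult_vec: "outer u v *v x = (v \<bullet> x) *\<^sub>R u"
  for u :: "real^'m" and v :: "real^'n"
  by (simp add: vec_eq_iff outer_def matrix_vector_mult_def inner_vec_def sum_distrib_left mult_ac)

lemma transpose_outer: "transpose (outer u v) = outer v u"
  for u v :: "'a::comm_semiring_1^'n"
  by (simp add: vec_eq_iff outer_def transpose_def mult.commute)

lemma outer_scaleR_left: "outer (k *\<^sub>R u) v = k *\<^sub>R outer u v"
  for u :: "real^'m" and v :: "real^'n"
  by (simp add: outer_def vec_eq_iff)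

lemma matrix_add_rdistrib: "(A + B) ** X = A ** X + B ** X"
  by (simp add: vec_eq_iff matrix_matrix_mult_def distrib_right sum.distrib)

lemma transpose_add: "transpose (A + B) = transpose A + transpose B"
  by (simp add: vec_eq_iff transpose_def)

text \<open>The determinant is a polynomial in the entries, so unlike a diagonalization it passes to
  the limit.\<close>

lemma tendsto_det_sylvester:
  fixes A :: "'t \<Rightarrow> real^'n^'n"
  assumes "(A \<longlongrightarrow> a) G"
  shows "((\<lambda>t. det (sylvester_matrix (complex_matrix (A t)))) \<longlongrightarrow> det (sylvester_matrix (complex_matrix a))) G"
  unfolding det_def sylvester_matrix_def complex_matrix_def using assms
  by (simp, intro tendsto_intros)

text \<open>The eigenvalues may be complex, so the determinant is taken over the complex numbers; a
  real solution is embedded entrywise.\<close>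

lemma sylvester_injective:
  fixes A :: "real^'n^'n"
  assumes det: "det (sylvester_matrix (complex_matrix A)) \<noteq> 0"
    and Y: "A ** Y + Y ** transpose A = 0"
  shows "Y = 0"
proof -
  have "complex_matrix A ** complex_matrix Y + complex_matrix Y ** transpose (complex_matrix A)
    = complex_matrix (A ** Y + Y ** transpose A)"
    by (simp add: vec_eq_iff complex_matrix_def matrix_matrix_mult_def transpose_def)
  also have "\<dots> = 0" by (simp add: Y vec_eq_iff complex_matrix_def)
  finally have "sylvester_matrix (complex_matrix A) *v (\<chi> p. complex_matrix Y $ fst p $ snd p) = 0"
    by (simp add: sylvester_matrix_mult_vec vec_eq_iff)
  then have "(\<chi> p. complex_matrix Y $ fst p $ snd p) = 0"
    using inj_matrix_vector_mult[of "sylvester_matrix (complex_matrix A)"] det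
    by (metis inj_eq invertible_det_nz matrix_vector_mult_0_right)
  then show "Y = 0"
    by (simp add: vec_eq_iff complex_matrix_def)
qed

text \<open>Each factor \<open>D $ i $ i + D $ j $ j\<close> has real part at least
  \<open>2 * \<delta>\<close>. The bound does not involve \<open>S\<close>, whose conditioning may
  degenerate along a family.\<close>

lemma det_sylvester_lower_bound:
  fixes A S D :: "complex^'n^'n"
  assumes "A ** S = S ** D" and "invertible S" and "\<And>i j. i \<noteq> j \<Longrightarrow> D $ i $ j = 0"
    and D_ge: "\<And>i. \<delta> \<le> Re (D $ i $ i)" and "0 < \<delta>"
  shows "(2 * \<delta>) ^ CARD('n \<times> 'n) \<le> norm (det (sylvester_matrix A))"
proof -
  have "2 * \<delta> \<le> norm (D $ i $ i + D $ j $ j)" for i j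
    using complex_Re_le_cmod[of "D $ i $ i + D $ j $ j"] D_ge[of i] D_ge[of j] by simp
  then have "(\<Prod>p\<in>(UNIV :: ('n \<times> 'n) set). 2 * \<delta>) \<le> (\<Prod>p\<in>UNIV. norm (D $ fst p $ fst p + D $ snd p $ snd p))"
    using \<open>0 < \<delta>\<close> by (intro prod_mono) auto
  then show ?thesis
    by (simp add: det_sylvester_matrix[OF assms(1-3)] prod_norm)
qed

text \<open>With the shifted matrix, the right side of the Lyapunov equation gains only terms in
  \<open>C w\<close> and \<open>v\<close>. So the limit of \<open>l C w\<close> is found first, and
  the limit of \<open>l C\<close> follows by inverting the limiting Sylvester operator.\<close>

lemma lyapunov_solution_asymptotics:
  fixes M C :: "'t \<Rightarrow> real^'n^'n" and Q :: "real^'n^'n"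
  assumes G: "G \<noteq> bot" and "0 < \<delta>"
    and spectrum: "\<forall>\<^sub>F t in G. complex_diagonalizable (M t) \<and> simple_eigenvalue (M t) (complex_of_real (l t)) \<and>
      0 < l t \<and> (\<forall>\<mu>. is_eigenvalue (M t) \<mu> \<and> \<mu> \<noteq> complex_of_real (l t) \<longrightarrow> \<delta> \<le> Re \<mu>)"
    and eigenvectors: "\<forall>\<^sub>F t in G. M t *v v t = l t *\<^sub>R v t \<and> w t v* M t = l t *\<^sub>R w t \<and> w t \<bullet> v t = 1"
    and lyapunov: "\<forall>\<^sub>F t in G. M t ** C t + C t ** transpose (M t) = Q \<and> transpose (C t) = C t"
    and lim: "(M \<longlongrightarrow> M\<^sub>c) G" "(l \<longlongrightarrow> 0) G" "(v \<longlongrightarrow> v\<^sub>c) G" "(w \<longlongrightarrow> w\<^sub>c) G"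
  shows "((\<lambda>t. l t *\<^sub>R C t) \<longlongrightarrow> (w\<^sub>c \<bullet> (Q *v w\<^sub>c) / 2) *\<^sub>R outer v\<^sub>c v\<^sub>c) G"
proof -
  define A where "A t = M t + \<delta> *\<^sub>R outer (v t) (w t)" for t
  define A\<^sub>c where "A\<^sub>c = M\<^sub>c + \<delta> *\<^sub>R outer v\<^sub>c w\<^sub>c"
  define s where "s t = w t \<bullet> (Q *v w t) / 2" for t
  define s\<^sub>c where "s\<^sub>c = w\<^sub>c \<bullet> (Q *v w\<^sub>c) / 2"
  have A_lim: "(A \<longlongrightarrow> A\<^sub>c) G"
    unfolding A_def A\<^sub>c_def by (intro tendsto_intros tendsto_outer lim)
  have s_lim: "(s \<longlongrightarrow> s\<^sub>c) G"
    unfolding s_def s\<^sub>c_def by (intro tendsto_intros tendsto_matrix_vector_mult lim) auto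

  have Mv_lim: "((\<lambda>t. M t *v v t) \<longlongrightarrow> M\<^sub>c *v v\<^sub>c) G"
    by (intro tendsto_matrix_vector_mult lim)
  have "((\<lambda>t. M t *v v t) \<longlongrightarrow> 0 *\<^sub>R v\<^sub>c) G"
    by (rule Lim_transform_eventually[OF tendsto_scaleR[OF lim(2,3)]])
      (use eigenvectors in eventually_elim, simp)
  then have Mv_c: "M\<^sub>c *v v\<^sub>c = 0"
    using tendsto_unique[OF G Mv_lim] by simp
  have "((\<lambda>t. w t \<bullet> v t) \<longlongrightarrow> 1) G"
    by (rule Lim_transform_eventually[OF tendsto_const]) (use eigenvectors in eventually_elim, simp)
  then have wv_c: "w\<^sub>c \<bullet> v\<^sub>c = 1"
    using tendsto_unique[OF G tendsto_inner[OF lim(4,3)]] by simp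
  \<comment> \<open>The shift moves the eigenvalue of \<open>v\<^sub>c\<close> from 0 to \<delta>;
    this is what identifies both limits below as images under the limiting operators.\<close>
  have Av_c: "A\<^sub>c *v v\<^sub>c = \<delta> *\<^sub>R v\<^sub>c"
    by (simp add: A\<^sub>c_def matrix_vector_mult_add_rdistrib Mv_c outer_mult_vec wv_c
        flip: scaleR_matrix_vector_assoc)

  \<comment> \<open>The bound depends only on \<delta> and the dimension, so it holds for the limit
    \<open>A\<^sub>c\<close> as well.\<close>
  have "\<forall>\<^sub>F t in G. (2 * \<delta>) ^ CARD('n \<times> 'n) \<le> norm (det (sylvester_matrix (complex_matrix (A t))))"
    using spectrum eigenvectors
  proof eventually_elim
    case (elim t)
    then obtain S D :: "complex^'n^'n"
      where "invertible S" "\<And>i j. i \<noteq> j \<Longrightarrow> D $ i $ j = 0"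
        "complex_matrix (A t) ** S = S ** D" "\<And>i. \<delta> \<le> Re (D $ i $ i)"
      unfolding A_def
      by (elim conjE deflated_diagonalization[of "M t" "l t" "v t" "w t" \<delta>]) auto
    then show ?case using \<open>0 < \<delta>\<close> by (intro det_sylvester_lower_bound)
  qed
  then have "(2 * \<delta>) ^ CARD('n \<times> 'n) \<le> norm (det (sylvester_matrix (complex_matrix A\<^sub>c)))"
    by (rule tendsto_lowerbound[OF tendsto_norm[OF tendsto_det_sylvester[OF A_lim]] _ G])
  moreover have "0 < (2 * \<delta>) ^ CARD('n \<times> 'n)"
    using \<open>0 < \<delta>\<close> by simp
  ultimately have "det (sylvester_matrix (complex_matrix A\<^sub>c)) \<noteq> 0"
    by auto
  note sylvester_inj = sylvester_injective[OF this]
  \<comment> \<open>if \<open>A\<^sub>c y = 0\<close>, then the Sylvester operator annihilates \<open>y y\<^sup>T\<close>\<close>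
  have A_inj: "y = 0" if "A\<^sub>c *v y = 0" for y
  proof -
    have "outer y y = 0"
      by (rule sylvester_inj) (simp add: matrix_mult_outer outer_mult_matrix that, simp add: outer_def vec_eq_iff)
    then show ?thesis by (simp add: outer_def vec_eq_iff)
  qed

  \<comment> \<open>The Lyapunov equation applied to \<open>w\<close> reads
    \<open>M (C w) + l (C w) = Q w\<close>. After shifting and scaling by \<open>l\<close>, the
    operator \<open>A + l\<close> acts on \<open>l C w\<close> and tends to the injective
    \<open>A\<^sub>c\<close>.\<close>
  have Cw_lim: "((\<lambda>t. l t *\<^sub>R (C t *v w t)) \<longlongrightarrow> s\<^sub>c *\<^sub>R v\<^sub>c) G"
  proof (rule tendsto_of_tendsto_linear_image[where L = "\<lambda>t u. A t *v u + l t *\<^sub>R u" and L\<^sub>c = "\<lambda>u. A\<^sub>c *v u"])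
    show "linear (\<lambda>u. A t *v u + l t *\<^sub>R u)" for t
      by (intro linear_compose_add matrix_vector_mul_linear linear_scale_self)
    show lin_c: "linear (\<lambda>u. A\<^sub>c *v u)"
      by (rule matrix_vector_mul_linear)
    show "inj (\<lambda>u. A\<^sub>c *v u)"
      using A_inj by (simp add: linear_injective_0[OF lin_c])
    show "((\<lambda>t. A t *v x + l t *\<^sub>R x) \<longlongrightarrow> A\<^sub>c *v x) G" for x
      using tendsto_add[OF tendsto_matrix_vector_mult[OF A_lim tendsto_const[of x]]
          tendsto_scaleR[OF lim(2) tendsto_const[of x]]] by simp
    have "((\<lambda>t. l t *\<^sub>R (Q *v w t) + (\<delta> * s t) *\<^sub>R v t) \<longlongrightarrow> 0 *\<^sub>R (Q *v w\<^sub>c) + (\<delta> * s\<^sub>c) *\<^sub>R v\<^sub>c) G"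
      by (intro tendsto_intros tendsto_matrix_vector_mult s_lim lim)
    moreover have "0 *\<^sub>R (Q *v w\<^sub>c) + (\<delta> * s\<^sub>c) *\<^sub>R v\<^sub>c = A\<^sub>c *v (s\<^sub>c *\<^sub>R v\<^sub>c)"
      by (simp add: Av_c matrix_vector_mult_scaleR)
    moreover have "\<forall>\<^sub>F t in G. l t *\<^sub>R (Q *v w t) + (\<delta> * s t) *\<^sub>R v t =
      A t *v (l t *\<^sub>R (C t *v w t)) + l t *\<^sub>R (l t *\<^sub>R (C t *v w t))"
      using eigenvectors lyapunov
    proof eventually_elim
      case (elim t)
      have MCw: "M t *v (C t *v w t) + l t *\<^sub>R (C t *v w t) = Q *v w t"
      proof -
        have "Q *v w t = M t *v (C t *v w t) + C t *v (w t v* M t)"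
          using elim by (metis matrix_vector_mul_assoc matrix_vector_mult_add_rdistrib transpose_matrix_vector)
        then show ?thesis using elim by (simp add: matrix_vector_mult_scaleR)
      qed
      \<comment> \<open>Pairing with the left eigenvector turns \<open>M\<close> into
        \<open>l\<close>, so \<open>2 l (w \<bullet> C w) = w \<bullet> Q w\<close>; this is the
        origin of the factor 1/2 in \<open>s\<close>.\<close>
      have "w t \<bullet> (M t *v x) = l t * (w t \<bullet> x)" for x
        using elim by (simp add: dot_lmul_matrix[symmetric])
      then have "l t * (w t \<bullet> (C t *v w t)) = s t"
        using arg_cong[OF MCw, of "\<lambda>x. w t \<bullet> x"] by (simp add: s_def inner_add_right)
      then show ?case
        by (simp add: A_def matrix_vector_mult_add_rdistrib outer_mult_vec MCw[symmetric]
            matrix_vector_mult_scaleR scaleR_add_right mult_ac flip: scaleR_matrix_vector_assoc)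
    qed
    ultimately show "((\<lambda>t. A t *v (l t *\<^sub>R (C t *v w t)) + l t *\<^sub>R (l t *\<^sub>R (C t *v w t)))
        \<longlongrightarrow> A\<^sub>c *v (s\<^sub>c *\<^sub>R v\<^sub>c)) G"
      by (simp only: Lim_transform_eventually)
  qed

  have linear_sylvester: "linear (\<lambda>X. B ** X + X ** transpose B)" for B :: "real^'n^'n"
    by (rule linearI) (simp_all add: matrix_add_ldistrib matrix_add_rdistrib scaleR_add_right matrix_scalar_ac scalar_matrix_assoc)
  show ?thesis unfolding s\<^sub>c_def[symmetric]
  proof (rule tendsto_of_tendsto_linear_image[where L = "\<lambda>t X. A t ** X + X ** transpose (A t)"
        and L\<^sub>c = "\<lambda>X. A\<^sub>c ** X + X ** transpose A\<^sub>c"])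
    show "linear (\<lambda>X. A t ** X + X ** transpose (A t))" for t
      by (rule linear_sylvester)
    show "linear (\<lambda>X. A\<^sub>c ** X + X ** transpose A\<^sub>c)"
      by (rule linear_sylvester)
    show "inj (\<lambda>X. A\<^sub>c ** X + X ** transpose A\<^sub>c)"
      unfolding linear_injective_0[OF linear_sylvester] using sylvester_inj by blast
    show "((\<lambda>t. A t ** X + X ** transpose (A t)) \<longlongrightarrow> A\<^sub>c ** X + X ** transpose A\<^sub>c) G" for X
      by (intro tendsto_add tendsto_matrix_matrix_mult tendsto_transpose A_lim tendsto_const)
    let ?d = "\<lambda>t. l t *\<^sub>R (C t *v w t)"
    have "((\<lambda>t. l t *\<^sub>R Q + \<delta> *\<^sub>R (outer (v t) (?d t) + outer (?d t) (v t)))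
       \<longlongrightarrow> 0 *\<^sub>R Q + \<delta> *\<^sub>R (outer v\<^sub>c (s\<^sub>c *\<^sub>R v\<^sub>c) + outer (s\<^sub>c *\<^sub>R v\<^sub>c) v\<^sub>c)) G"
      by (intro tendsto_intros tendsto_outer Cw_lim lim)
    \<comment> \<open>Both sides equal \<open>2 * \<delta> * s\<^sub>c\<close> times
      \<open>outer v\<^sub>c v\<^sub>c\<close>.\<close>
    moreover have "0 *\<^sub>R Q + \<delta> *\<^sub>R (outer v\<^sub>c (s\<^sub>c *\<^sub>R v\<^sub>c) + outer (s\<^sub>c *\<^sub>R v\<^sub>c) v\<^sub>c)
      = A\<^sub>c ** (s\<^sub>c *\<^sub>R outer v\<^sub>c v\<^sub>c) + (s\<^sub>c *\<^sub>R outer v\<^sub>c v\<^sub>c) ** transpose A\<^sub>c"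
    proof -
      have "s\<^sub>c *\<^sub>R outer v\<^sub>c v\<^sub>c = outer v\<^sub>c (s\<^sub>c *\<^sub>R v\<^sub>c)"
        by (simp add: outer_def vec_eq_iff)
      then show ?thesis
        by (simp add: matrix_mult_outer outer_mult_matrix Av_c matrix_vector_mult_scaleR)
          (simp add: outer_def vec_eq_iff)
    qed
    moreover have "\<forall>\<^sub>F t in G. l t *\<^sub>R Q + \<delta> *\<^sub>R (outer (v t) (?d t) + outer (?d t) (v t)) =
      A t ** (l t *\<^sub>R C t) + (l t *\<^sub>R C t) ** transpose (A t)"
      using lyapunov
    proof eventually_elim
      case (elim t)
      \<comment> \<open>Symmetry of \<open>C\<close> makes the two shift terms transposes of each
        other, both expressed through \<open>C w\<close>.\<close>
      have wC: "w t v* C t = C t *v w t"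
        using elim by (metis transpose_matrix_vector)
      have "A t ** C t + C t ** transpose (A t)
        = (M t ** C t + C t ** transpose (M t)) + \<delta> *\<^sub>R (outer (v t) (C t *v w t) + outer (C t *v w t) (v t))"
        by (simp add: A_def transpose_add transpose_scalar transpose_outer matrix_add_ldistrib matrix_add_rdistrib
          matrix_mult_outer outer_mult_matrix outer_scaleR_left wC scaleR_add_right matrix_scalar_ac
          flip: scalar_matrix_assoc scaleR_matrix_vector_assoc)
      also have "l t *\<^sub>R \<dots> = l t *\<^sub>R Q + \<delta> *\<^sub>R (outer (v t) (?d t) + outer (?d t) (v t))"
        unfolding conjunct1[OF elim] by (simp add: outer_def vec_eq_iff algebra_simps)
      finally show ?case
        by (simp add: scaleR_add_right matrix_scalar_ac scalar_matrix_assoc)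
    qed
    ultimately show "((\<lambda>t. A t ** (l t *\<^sub>R C t) + (l t *\<^sub>R C t) ** transpose (A t)) \<longlongrightarrow>
      A\<^sub>c ** (s\<^sub>c *\<^sub>R outer v\<^sub>c v\<^sub>c) + (s\<^sub>c *\<^sub>R outer v\<^sub>c v\<^sub>c) ** transpose A\<^sub>c) G"
      by (simp only: Lim_transform_eventually)
  qed
qed

section \<open>Moments of Gaussian vectors\<close>

text \<open>Positive variance reduces to the moments of the normal density; zero variance means that
  \<open>Y\<close> vanishes almost surely.\<close>

lemma (in prob_space) centered_normal_moments:
  assumes Y: "normal_rv M Y 0 s2"
  shows "has_bochner_integral M Y 0"
    and "has_bochner_integral M (\<lambda>\<omega>. Y \<omega> ^ 2) s2"
    and "has_bochner_integral M (\<lambda>\<omega>. Y \<omega> ^ 3) 0"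
    and "has_bochner_integral M (\<lambda>\<omega>. Y \<omega> ^ 4) (3 * s2\<^sup>2)"
proof -
  have "has_bochner_integral M Y 0 \<and> has_bochner_integral M (\<lambda>\<omega>. Y \<omega> ^ 2) s2 \<and>
    has_bochner_integral M (\<lambda>\<omega>. Y \<omega> ^ 3) 0 \<and> has_bochner_integral M (\<lambda>\<omega>. Y \<omega> ^ 4) (3 * s2\<^sup>2)"
  proof (cases "0 < s2")
    case True
    then have D: "distributed M lborel Y (normal_density 0 (sqrt s2))"
      using Y by (simp add: normal_rv_def)
    have transfer: "has_bochner_integral M (\<lambda>\<omega>. Y \<omega> ^ k) c"
      if "has_bochner_integral lborel (\<lambda>y. normal_density 0 (sqrt s2) y * (y - 0) ^ k) c" for k c
      using that distributed_integrable[OF D, of "\<lambda>y. y ^ k"] distributed_integral[OF D, of "\<lambda>y. y ^ k"]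
      by (auto simp: has_bochner_integral_iff)
    show ?thesis
      \<comment> \<open>The odd formula at 0 and 1 gives the powers 1 and 3, the even one at 1 and 2
        the powers 2 and 4.\<close>
      using transfer[OF normal_moment_odd[of "sqrt s2" 0 0]] transfer[OF normal_moment_even[of "sqrt s2" 0 1]]
        transfer[OF normal_moment_odd[of "sqrt s2" 0 1]]
        transfer[OF normal_moment_even[of "sqrt s2" 0 2]] True
      by (simp add: power_divide fact_numeral field_simps power2_eq_square power3_eq_cube)
  next
    case False
    then have "s2 = 0" and [measurable]: "Y \<in> borel_measurable M" and ae: "AE \<omega> in M. Y \<omega> = 0"
      using Y by (auto simp: normal_rv_def split: if_splits)
    have "has_bochner_integral M (\<lambda>\<omega>. Y \<omega> ^ k) 0" if "k > 0" for k
    proof -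
      have "has_bochner_integral M (\<lambda>\<omega>. Y \<omega> ^ k) 0 \<longleftrightarrow> has_bochner_integral M (\<lambda>_. 0 :: real) 0"
        using ae that by (intro has_bochner_integral_cong_AE) auto
      then show ?thesis by (simp add: has_bochner_integral_zero)
    qed
    from this[of 1] this[of 2] this[of 3] this[of 4] \<open>s2 = 0\<close> show ?thesis by simp
  qed
  then show "has_bochner_integral M Y 0"
    and "has_bochner_integral M (\<lambda>\<omega>. Y \<omega> ^ 2) s2"
    and "has_bochner_integral M (\<lambda>\<omega>. Y \<omega> ^ 3) 0"
    and "has_bochner_integral M (\<lambda>\<omega>. Y \<omega> ^ 4) (3 * s2\<^sup>2)"
    by blast+
qed

lemma inner_matrix_vector_mult_commute:
  fixes C :: "real^'n^'n"
  assumes "transpose C = C"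
  shows "b \<bullet> (C *v a) = a \<bullet> (C *v b)"
  by (metis assms dot_lmul_matrix inner_commute transpose_matrix_vector)

context prob_space
begin

context
  fixes Z :: "'a \<Rightarrow> real^'n" and C :: "real^'n^'n"
  assumes Z: "multivariate_normal M Z 0 C"
begin

private lemma symC: "transpose C = C"
  using Z by (simp add: multivariate_normal_def)

private lemma functional: "normal_rv M (\<lambda>\<omega>. a \<bullet> Z \<omega>) 0 (a \<bullet> (C *v a))"
  using Z by (simp add: multivariate_normal_def)

private lemmas moments = centered_normal_moments[OF functional]

lemma multivariate_normal_moment1: "has_bochner_integral M (\<lambda>\<omega>. a \<bullet> Z \<omega>) 0"
  by (rule moments)

lemma multivariate_normal_moment2: "has_bochner_integral M (\<lambda>\<omega>. (a \<bullet> Z \<omega>)\<^sup>2) (a \<bullet> (C *v a))"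
  by (rule moments)

text \<open>Polarization: \<open>(y + x)^3 - (y - x)^3 - 2 * x^3 = 6 * x * y^2\<close>, and the
  third moment of every functional vanishes.\<close>

lemma multivariate_normal_moment12:
  "has_bochner_integral M (\<lambda>\<omega>. (a \<bullet> Z \<omega>) * (b \<bullet> Z \<omega>)\<^sup>2) 0"
proof -
  have "has_bochner_integral M (\<lambda>\<omega>. (((b + a) \<bullet> Z \<omega>) ^ 3 - ((b - a) \<bullet> Z \<omega>) ^ 3 - 2 * (a \<bullet> Z \<omega>) ^ 3) / 6)
     ((0 - 0 - 2 * 0) / 6)"
    by (intro has_bochner_integral_divide_zero has_bochner_integral_diff has_bochner_integral_mult_right moments)
  then show ?thesis
    by (simp add: inner_simps power2_eq_square power3_eq_cube algebra_simps)
qed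

text \<open>An instance of Isserlis' formula, obtained by polarizing fourth powers along
  \<open>a + b\<close> and \<open>a - b\<close>.\<close>

lemma multivariate_normal_moment22:
  "has_bochner_integral M (\<lambda>\<omega>. (a \<bullet> Z \<omega>)\<^sup>2 * (b \<bullet> Z \<omega>)\<^sup>2)
     ((a \<bullet> (C *v a)) * (b \<bullet> (C *v b)) + 2 * (a \<bullet> (C *v b))\<^sup>2)"
proof -
  let ?q = "\<lambda>a. a \<bullet> (C *v a)"
  have q: "?q (a + b) = ?q a + ?q b + 2 * (a \<bullet> (C *v b))" "?q (a - b) = ?q a + ?q b - 2 * (a \<bullet> (C *v b))"
    using inner_matrix_vector_mult_commute[OF symC, of b a]
    by (simp_all add: inner_simps matrix_vector_mult_add_rdistrib matrix_vector_right_distrib matrix_vector_mult_diff_distrib)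
  have polarize: "((x + y) ^ 4 + (x - y) ^ 4 - 2 * x ^ 4 - 2 * y ^ 4) / 12 = x\<^sup>2 * y\<^sup>2" for x y :: real
    by (simp add: field_simps) algebra
  have value_eq: "(3 * (x + y + 2 * t)\<^sup>2 + 3 * (x + y - 2 * t)\<^sup>2 - 2 * (3 * x\<^sup>2) - 2 * (3 * y\<^sup>2)) / 12
     = x * y + 2 * t\<^sup>2" for x y t :: real
    by (simp add: power2_eq_square algebra_simps)
  have "has_bochner_integral M (\<lambda>\<omega>. (((a + b) \<bullet> Z \<omega>) ^ 4 + ((a - b) \<bullet> Z \<omega>) ^ 4
       - 2 * (a \<bullet> Z \<omega>) ^ 4 - 2 * (b \<bullet> Z \<omega>) ^ 4) / 12)
     ((3 * (?q (a + b))\<^sup>2 + 3 * (?q (a - b))\<^sup>2 - 2 * (3 * (?q a)\<^sup>2) - 2 * (3 * (?q b)\<^sup>2)) / 12)"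
    by (intro has_bochner_integral_divide_zero has_bochner_integral_diff has_bochner_integral_add
        has_bochner_integral_mult_right moments)
  then show ?thesis
    unfolding q value_eq unfolding inner_add_left inner_diff_left polarize .
qed

text \<open>Writing the quadratic part as a sum of squared functionals reduces everything to the
  polarized moments. Cross terms with the linear part are of odd order and vanish.\<close>

lemma multivariate_normal_quadratic:
  fixes p :: "'i \<Rightarrow> real^'n" and I :: "'i set" and b :: "real^'n" and c :: real
  defines "Y \<equiv> \<lambda>\<omega>. c + b \<bullet> Z \<omega> + (\<Sum>i\<in>I. (p i \<bullet> Z \<omega>)\<^sup>2)"
  shows "expectation Y = c + (\<Sum>i\<in>I. p i \<bullet> (C *v p i))"
    and "variance Y = b \<bullet> (C *v b) + 2 * (\<Sum>i\<in>I. \<Sum>j\<in>I. (p i \<bullet> (C *v p j))\<^sup>2)"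
proof -
  let ?q = "\<lambda>a. a \<bullet> (C *v a)"
  have "has_bochner_integral M Y (c * measure M (space M) + 0 + (\<Sum>i\<in>I. ?q (p i)))"
    unfolding Y_def
    by (intro has_bochner_integral_add has_bochner_integral_sum multivariate_normal_moment1
        multivariate_normal_moment2) (simp add: has_bochner_integral_iff prob_space)
  then show E: "expectation Y = c + (\<Sum>i\<in>I. ?q (p i))"
    by (simp add: prob_space has_bochner_integral_iff)
  define e where "e = (\<Sum>i\<in>I. ?q (p i))"
  \<comment> \<open>The expanded square of the centered \<open>Y\<close>, from which
    \<open>c\<close> has cancelled. On the right the products of variances sum to
    \<open>e\<^sup>2\<close> and cancel against \<open>e\<^sup>2 - 2 * e * e\<close>.\<close>
  have "has_bochner_integral M (\<lambda>\<omega>. (b \<bullet> Z \<omega>)\<^sup>2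
      + (\<Sum>i\<in>I. \<Sum>j\<in>I. (p i \<bullet> Z \<omega>)\<^sup>2 * (p j \<bullet> Z \<omega>)\<^sup>2) + e\<^sup>2
      + 2 * (\<Sum>i\<in>I. (b \<bullet> Z \<omega>) * (p i \<bullet> Z \<omega>)\<^sup>2) - (2 * e) * (b \<bullet> Z \<omega>)
      - (2 * e) * (\<Sum>i\<in>I. (p i \<bullet> Z \<omega>)\<^sup>2))
    (?q b + (\<Sum>i\<in>I. \<Sum>j\<in>I. ?q (p i) * ?q (p j) + 2 * (p i \<bullet> (C *v p j))\<^sup>2)
      + e\<^sup>2 * measure M (space M) + 2 * (\<Sum>i\<in>I. 0) - (2 * e) * 0 - (2 * e) * e)"
    unfolding e_def
    by (intro has_bochner_integral_add has_bochner_integral_diff has_bochner_integral_sum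
        has_bochner_integral_mult_right multivariate_normal_moment1
        multivariate_normal_moment2 multivariate_normal_moment12 multivariate_normal_moment22)
      (simp add: has_bochner_integral_iff prob_space)
  also have "(\<lambda>\<omega>. (b \<bullet> Z \<omega>)\<^sup>2
      + (\<Sum>i\<in>I. \<Sum>j\<in>I. (p i \<bullet> Z \<omega>)\<^sup>2 * (p j \<bullet> Z \<omega>)\<^sup>2) + e\<^sup>2
      + 2 * (\<Sum>i\<in>I. (b \<bullet> Z \<omega>) * (p i \<bullet> Z \<omega>)\<^sup>2) - (2 * e) * (b \<bullet> Z \<omega>)
      - (2 * e) * (\<Sum>i\<in>I. (p i \<bullet> Z \<omega>)\<^sup>2)) = (\<lambda>\<omega>. (Y \<omega> - expectation Y)\<^sup>2)" (is "?f = _")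
  proof (rule ext)
    fix \<omega>
    have "x\<^sup>2 + s * s + e\<^sup>2 + 2 * (x * s) - 2 * e * x - 2 * e * s = (c + x + s - (c + e))\<^sup>2" for x s :: real
      by (simp add: power2_eq_square algebra_simps)
    then show "?f \<omega> = (Y \<omega> - expectation Y)\<^sup>2"
      unfolding E e_def[symmetric] unfolding Y_def
      unfolding sum_product[symmetric] unfolding sum_distrib_left[symmetric] .
  qed
  finally show "variance Y = ?q b + 2 * (\<Sum>i\<in>I. \<Sum>j\<in>I. (p i \<bullet> (C *v p j))\<^sup>2)"
    by (simp add: has_bochner_integral_iff prob_space sum.distrib sum_product[symmetric]
        sum_distrib_left[symmetric] sum_distrib_right[symmetric] e_def[symmetric] power2_eq_square)
qed

end
end

section \<open>Linearization along the branch\<close>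

lemma linearization_eq_partial_derivative:
  assumes "((\<lambda>(x, \<alpha>). F x \<alpha>) has_derivative f') (at (xs \<alpha>, \<alpha>))"
  shows "linearization F xs \<alpha> = - (\<chi> i j. f' (axis j 1, 0) $ i)"
proof -
  have "((\<lambda>x. (x, \<alpha>)) has_derivative (\<lambda>h. (h, 0))) (at (xs \<alpha>))"
    by (intro derivative_intros)
  from has_derivative_compose[OF this, of "\<lambda>(x, \<alpha>). F x \<alpha>" f'] assms
  have "((\<lambda>x. F x \<alpha>) has_derivative (\<lambda>h. f' (h, 0))) (at (xs \<alpha>))"
    by simp
  from frechet_derivative_at[OF this] show ?thesis
    by (simp add: linearization_def jacobian_def matrix_def vec_eq_iff fun_eq_iff)
qed

text \<open>The total derivative \<open>f'\<close> is itself differentiable, hence continuous, at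
  the endpoint; the entries of the linearization are its values in fixed directions
  \<open>(axis j 1, 0)\<close>.\<close>

lemma tendsto_linearization:
  fixes F :: "real^'n \<Rightarrow> real \<Rightarrow> real^'n"
  assumes C2: "C2_on (\<lambda>(x, \<alpha>). F x \<alpha>) U" and branch: "\<forall>\<^sub>F \<alpha> in at_left \<alpha>\<^sub>c. (xs \<alpha>, \<alpha>) \<in> U"
    and endpoint: "(x\<^sub>c, \<alpha>\<^sub>c) \<in> U" and xs: "(xs \<longlongrightarrow> x\<^sub>c) (at_left \<alpha>\<^sub>c)"
  obtains M\<^sub>c where "(linearization F xs \<longlongrightarrow> M\<^sub>c) (at_left \<alpha>\<^sub>c)"
proof -
  obtain f' :: "(real^'n) \<times> real \<Rightarrow> ((real^'n) \<times> real) \<Rightarrow>\<^sub>L (real^'n)"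
    and f'' :: "(real^'n) \<times> real \<Rightarrow> ((real^'n) \<times> real) \<Rightarrow>\<^sub>L ((real^'n) \<times> real) \<Rightarrow>\<^sub>L (real^'n)"
    where f': "\<forall>p\<in>U. ((\<lambda>(x, \<alpha>). F x \<alpha>) has_derivative blinfun_apply (f' p)) (at p)"
      and f'': "\<forall>p\<in>U. (f' has_derivative blinfun_apply (f'' p)) (at p)"
    using C2 unfolding C2_on_def by (elim conjE exE)
  have "isCont f' (x\<^sub>c, \<alpha>\<^sub>c)"
    using bspec[OF f'' endpoint] by (rule has_derivative_continuous)
  moreover have "((\<lambda>\<alpha>. (xs \<alpha>, \<alpha>)) \<longlongrightarrow> (x\<^sub>c, \<alpha>\<^sub>c)) (at_left \<alpha>\<^sub>c)"
    by (intro tendsto_Pair xs tendsto_ident_at)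
  ultimately have lim: "((\<lambda>\<alpha>. f' (xs \<alpha>, \<alpha>)) \<longlongrightarrow> f' (x\<^sub>c, \<alpha>\<^sub>c)) (at_left \<alpha>\<^sub>c)"
    by (rule isCont_tendsto_compose)
  have "((\<lambda>\<alpha>. - (\<chi> i j. f' (xs \<alpha>, \<alpha>) (axis j 1, 0) $ i)) \<longlongrightarrow>
      - (\<chi> i j. f' (x\<^sub>c, \<alpha>\<^sub>c) (axis j 1, 0) $ i)) (at_left \<alpha>\<^sub>c)"
    by (intro tendsto_intros lim)
  moreover have "\<forall>\<^sub>F \<alpha> in at_left \<alpha>\<^sub>c. - (\<chi> i j. f' (xs \<alpha>, \<alpha>) (axis j 1, 0) $ i) = linearization F xs \<alpha>"
    using branch by eventually_elim (simp add: linearization_eq_partial_derivative[OF bspec[OF f']])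
  ultimately show ?thesis
    using that Lim_transform_eventually by blast
qed

section \<open>Spatial variance\<close>

text \<open>The literal \<open>1\<close> is the all-ones vector, so centering subtracts the mean of
  the components.\<close>

lemma centering_mult_vec: "centering *v x = x - ((1 \<bullet> x) / real CARD('n)) *\<^sub>R 1"
  for x :: "real^'n"
  by (simp add: vec_eq_iff centering_def matrix_vector_mult_diff_rdistrib inner_vec_def
      flip: scaleR_matrix_vector_assoc)
    (simp add: matrix_vector_mult_def)

lemma one_inner_one: "(1 :: real^'n) \<bullet> 1 = real CARD('n)"
  by (simp add: inner_vec_def)

text \<open>Pythagoras along the all-ones direction. For the unit vector \<open>v\<^sub>c\<close>
  this is one minus the uniformity ratio of the theorem.\<close>

lemma norm_centering_mult_vec: "(norm (centering *v x))\<^sup>2 = (norm x)\<^sup>2 - (1 \<bullet> x)\<^sup>2 / real CARD('n)"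
  for x :: "real^'n"
  unfolding power2_norm_eq_inner centering_mult_vec
  by (simp add: inner_diff_left inner_diff_right one_inner_one
      inner_commute[of x 1] power2_eq_square)

text \<open>Centering is an orthogonal projection. The fluctuation part thus becomes the spatial
  variance with zero mean state.\<close>

lemma V_fluc_eq_spatial_variance: "V_fluc x = spatial_variance x"
  unfolding V_fluc_def spatial_variance_def norm_centering_mult_vec unfolding centering_mult_vec
  by (simp add: inner_diff_right power2_norm_eq_inner[symmetric] inner_commute[of _ 1] power2_eq_square[of "1 \<bullet> x"])

lemma transpose_centering: "transpose centering = centering"
  by (simp add: centering_def transpose_def vec_eq_iff mat_def)

lemma centering_idem: "centering ** centering = (centering :: real^'n^'n)"
proof -
  have "(centering ** centering) *v x = (centering :: real^'n^'n) *v x" for x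
    by (simp flip: matrix_vector_mul_assoc)
      (simp add: centering_mult_vec inner_diff_right one_inner_one)
  then show ?thesis by (simp add: matrix_eq)
qed

lemma centering_mult_vec_nth: "(centering *v x) $ i = (centering $ i) \<bullet> x"
  by (simp add: matrix_vector_mult_def inner_vec_def)

text \<open>Supplies the sum of squared functionals that
  \<open>multivariate_normal_quadratic\<close> expects.\<close>

lemma norm_centering_mult_vec_sum: "(norm (centering *v x))\<^sup>2 = (\<Sum>i\<in>UNIV. ((centering $ i) \<bullet> x)\<^sup>2)"
  unfolding power2_norm_eq_inner inner_vec_def[of "centering *v x"] centering_mult_vec_nth
  by (simp add: power2_eq_square)

text \<open>Idempotence and cyclicity turn the trace into that of \<open>R ** R\<close> with
  \<open>R = P C P\<close>; as \<open>R\<close> is symmetric, this is its squared Frobenius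
  norm.\<close>

lemma trace_centered_covariance:
  fixes C :: "real^'n^'n"
  assumes "transpose C = C"
  shows "trace (centering ** C ** centering ** C) =
    (\<Sum>i\<in>UNIV. \<Sum>j\<in>UNIV. ((centering $ i) \<bullet> (C *v (centering $ j)))\<^sup>2)"
proof -
  let ?P = "centering :: real^'n^'n"
  define R where "R = ?P ** C ** ?P"
  have col: "?P $ k $ j = ?P $ j $ k" for j k
    using arg_cong[OF transpose_centering, of "\<lambda>X. X $ j $ k"] by (simp add: transpose_def)
  have R: "R $ i $ j = (?P $ i) \<bullet> (C *v (?P $ j))" for i j
    unfolding R_def matrix_mul_assoc[symmetric]
    by (simp add: matrix_matrix_mult_def inner_vec_def matrix_vector_mult_def col[of _ j])
  have R_sym: "R $ j $ i = R $ i $ j" for i j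
    unfolding R by (rule inner_matrix_vector_mult_commute[OF assms])
  have "trace (?P ** C ** ?P ** C) = trace (?P ** (?P ** C ** ?P ** C))"
    by (simp add: matrix_mul_assoc centering_idem)
  also have "\<dots> = trace ((?P ** C ** ?P ** C) ** ?P)"
    by (rule trace_mul_sym)
  also have "\<dots> = trace (R ** R)"
  proof -
    have "R ** R = ?P ** C ** (?P ** ?P) ** C ** ?P"
      by (simp only: R_def matrix_mul_assoc)
    then show ?thesis by (simp add: centering_idem)
  qed
  also have "\<dots> = (\<Sum>i\<in>UNIV. \<Sum>j\<in>UNIV. (R $ i $ j)\<^sup>2)"
    by (simp add: trace_def matrix_matrix_mult_def R_sym power2_eq_square)
  finally show ?thesis by (simp add: R)
qed

text \<open>Expanding the squared norm at \<open>m + Z\<close> gives a quadratic with linear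
  coefficient \<open>2 *\<^sub>R (P *v m)\<close>, whence the factor 4 in the variance.\<close>

lemma (in prob_space) spatial_variance_moments:
  fixes Z :: "'a \<Rightarrow> real^'n"
  assumes Z: "multivariate_normal M Z 0 C"
  defines "P \<equiv> centering :: real^'n^'n"
  shows "expectation (\<lambda>\<omega>. spatial_variance (m + Z \<omega>)) =
      ((norm (P *v m))\<^sup>2 + (\<Sum>i\<in>UNIV. (P $ i) \<bullet> (C *v (P $ i)))) / (real CARD('n) - 1)"
    and "variance (\<lambda>\<omega>. spatial_variance (m + Z \<omega>)) =
      (4 * ((P *v m) \<bullet> (C *v (P *v m))) + 2 * (\<Sum>i\<in>UNIV. \<Sum>j\<in>UNIV. ((P $ i) \<bullet> (C *v (P $ j)))\<^sup>2))
        / (real CARD('n) - 1)\<^sup>2"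
proof -
  let ?k = "real CARD('n) - 1"
  let ?Y = "\<lambda>\<omega>. (norm (P *v m))\<^sup>2 + (2 *\<^sub>R (P *v m)) \<bullet> Z \<omega> + (\<Sum>i\<in>UNIV. ((P $ i) \<bullet> Z \<omega>)\<^sup>2)"
  have Y: "spatial_variance (m + Z \<omega>) = ?Y \<omega> / ?k" for \<omega>
  proof -
    have "(P *v m) \<bullet> (P *v Z \<omega>) = (P *v m) \<bullet> Z \<omega>"
      using inner_matrix_vector_mult_commute[OF transpose_centering, of "P *v m" "Z \<omega>"]
      by (simp add: P_def matrix_vector_mul_assoc centering_idem inner_commute)
    then have "(norm (P *v (m + Z \<omega>)))\<^sup>2 = ?Y \<omega>"
      unfolding P_def norm_centering_mult_vec_sum[of "Z \<omega>", symmetric]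
      by (simp add: power2_norm_eq_inner matrix_vector_right_distrib inner_simps
          inner_commute[of "centering *v Z \<omega>" "centering *v m"])
    then show ?thesis by (simp add: spatial_variance_def P_def)
  qed
  note moments = multivariate_normal_quadratic[OF Z, where c = "(norm (P *v m))\<^sup>2" and b = "2 *\<^sub>R (P *v m)"
        and I = UNIV and p = "\<lambda>i. P $ i"]
  show "expectation (\<lambda>\<omega>. spatial_variance (m + Z \<omega>)) =
      ((norm (P *v m))\<^sup>2 + (\<Sum>i\<in>UNIV. (P $ i) \<bullet> (C *v (P $ i)))) / ?k"
    unfolding Y by (simp only: integral_divide_zero moments(1))
  have "variance (\<lambda>\<omega>. spatial_variance (m + Z \<omega>)) = variance ?Y / ?k\<^sup>2"
    unfolding Y by (simp only: integral_divide_zero diff_divide_distrib[symmetric] power_divide)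
  then show "variance (\<lambda>\<omega>. spatial_variance (m + Z \<omega>)) =
      (4 * ((P *v m) \<bullet> (C *v (P *v m))) + 2 * (\<Sum>i\<in>UNIV. \<Sum>j\<in>UNIV. ((P $ i) \<bullet> (C *v (P $ j)))\<^sup>2)) / ?k\<^sup>2"
    by (simp only: moments(2)) (simp add: matrix_vector_mult_scaleR)
qed

text \<open>Multiplying standard deviation and mean by \<open>l t\<close> keeps their ratio and
  replaces \<open>C t\<close> by a convergent family. The location \<open>m t\<close> is left free
  so that one lemma serves both limits.\<close>

lemma spatial_variance_coefficient_of_variation:
  fixes Z :: "'t \<Rightarrow> 'a \<Rightarrow> real^'n"
  assumes dim: "CARD('n) \<ge> 2"
    and prob: "\<forall>\<^sub>F t in G. prob_space (\<Omega> t) \<and> multivariate_normal (\<Omega> t) (Z t) 0 (C t) \<and> 0 < l t"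
    and lim: "(l \<longlongrightarrow> 0) G" "(m \<longlongrightarrow> m\<^sub>c) G" "((\<lambda>t. l t *\<^sub>R C t) \<longlongrightarrow> s *\<^sub>R outer v v) G"
    and "0 < s" and v: "norm (centering *v v) \<noteq> 0"
  shows "((\<lambda>t. sd (\<Omega> t) (\<lambda>\<omega>. spatial_variance (m t + Z t \<omega>)) /
     prob_space.expectation (\<Omega> t) (\<lambda>\<omega>. spatial_variance (m t + Z t \<omega>))) \<longlongrightarrow> sqrt 2) G"
proof -
  define P where "P = (centering :: real^'n^'n)"
  define q where "q = (norm (P *v v))\<^sup>2"
  define S where "S X = (\<Sum>i\<in>UNIV. \<Sum>j\<in>UNIV. ((P $ i) \<bullet> (X *v (P $ j)))\<^sup>2)" for X
  define T where "T X = (\<Sum>i\<in>UNIV. (P $ i) \<bullet> (X *v (P $ i)))" for X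
  define b where "b t = P *v m t" for t
  let ?D = "s *\<^sub>R outer v v" and ?k = "real CARD('n) - 1"
  let ?C = "\<lambda>t. l t *\<^sub>R C t"
  have q: "q = (\<Sum>i\<in>UNIV. ((P $ i) \<bullet> v)\<^sup>2)"
    by (simp add: q_def P_def norm_centering_mult_vec_sum)
  have "q > 0" using v by (simp add: q_def P_def)
  \<comment> \<open>The rank one form factors, so the double sum \<open>S\<close> becomes the square
    of the single sum \<open>T\<close>.\<close>
  have D: "a \<bullet> (?D *v a') = s * ((a \<bullet> v) * (a' \<bullet> v))" for a a'
    by (simp add: outer_mult_vec inner_commute flip: scaleR_matrix_vector_assoc)
  have TD: "T ?D = s * q"
    by (simp add: T_def D q power2_eq_square sum_distrib_left)
  have SD: "S ?D = (s * q)\<^sup>2"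
  proof -
    have "S ?D = (\<Sum>i\<in>UNIV. \<Sum>j\<in>UNIV. s\<^sup>2 * (((P $ i) \<bullet> v)\<^sup>2 * ((P $ j) \<bullet> v)\<^sup>2))"
      by (simp add: S_def D power_mult_distrib)
    also have "\<dots> = s\<^sup>2 * (q * q)"
      unfolding q sum_product by (simp add: sum_distrib_left)
    finally show ?thesis by (simp add: power2_eq_square)
  qed
  have b_lim: "(b \<longlongrightarrow> P *v m\<^sub>c) G"
    unfolding b_def by (intro tendsto_matrix_vector_mult tendsto_const lim)
  \<comment> \<open>The variance scales by the square of \<open>l t\<close>: in the \<open>b\<close>
    term one factor rescales the covariance, and the spare one sends the term to 0.\<close>
  have "((\<lambda>t. sqrt (4 * l t * (b t \<bullet> (?C t *v b t)) + 2 * S (?C t)) / (l t * (norm (P *v m t))\<^sup>2 + T (?C t)))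
     \<longlongrightarrow> sqrt (4 * 0 * ((P *v m\<^sub>c) \<bullet> (?D *v (P *v m\<^sub>c))) + 2 * S ?D) / (0 * (norm (P *v m\<^sub>c))\<^sup>2 + T ?D)) G"
    unfolding S_def T_def
    by (intro tendsto_intros tendsto_matrix_vector_mult lim b_lim)
      (use \<open>q > 0\<close> \<open>0 < s\<close> TD in \<open>simp add: T_def\<close>)
  moreover have "sqrt (4 * 0 * ((P *v m\<^sub>c) \<bullet> (?D *v (P *v m\<^sub>c))) + 2 * S ?D) / (0 * (norm (P *v m\<^sub>c))\<^sup>2 + T ?D) = sqrt 2"
    using \<open>q > 0\<close> \<open>0 < s\<close> by (simp add: SD TD real_sqrt_mult)
  moreover have "\<forall>\<^sub>F t in G. sqrt (4 * l t * (b t \<bullet> (?C t *v b t)) + 2 * S (?C t)) / (l t * (norm (P *v m t))\<^sup>2 + T (?C t))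
    = sd (\<Omega> t) (\<lambda>\<omega>. spatial_variance (m t + Z t \<omega>)) /
     prob_space.expectation (\<Omega> t) (\<lambda>\<omega>. spatial_variance (m t + Z t \<omega>))"
    using prob
  proof eventually_elim
    case (elim t)
    then interpret prob_space "\<Omega> t" by simp
    have Z: "multivariate_normal (\<Omega> t) (Z t) 0 (C t)" and l: "0 < l t" using elim by auto
    let ?X = "4 * (b t \<bullet> (C t *v b t)) + 2 * S (C t)" and ?Y = "(norm (P *v m t))\<^sup>2 + T (C t)"
    have "4 * l t * (b t \<bullet> (?C t *v b t)) + 2 * S (?C t) = (l t)\<^sup>2 * ?X"
      by (simp add: S_def power_mult_distrib power2_eq_square algebra_simps sum_distrib_left flip: scaleR_matrix_vector_assoc)
    moreover have "l t * (norm (P *v m t))\<^sup>2 + T (?C t) = l t * ?Y"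
      by (simp add: T_def algebra_simps sum_distrib_left flip: scaleR_matrix_vector_assoc)
    moreover have "sqrt ((l t)\<^sup>2 * ?X) / (l t * ?Y) = sqrt ?X / ?Y"
      using l by (simp add: real_sqrt_mult)
    moreover have "sqrt ?X / ?Y = sqrt (?X / ?k\<^sup>2) / (?Y / ?k)"
      using dim by (simp add: real_sqrt_divide)
    moreover have "expectation (\<lambda>\<omega>. spatial_variance (m t + Z t \<omega>)) = ?Y / ?k"
      unfolding spatial_variance_moments(1)[OF Z] T_def P_def ..
    moreover have "variance (\<lambda>\<omega>. spatial_variance (m t + Z t \<omega>)) = ?X / ?k\<^sup>2"
      unfolding spatial_variance_moments(2)[OF Z] S_def P_def b_def ..
    ultimately show ?case
      by (simp only: sd_def)
  qed
  ultimately show ?thesis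
    by (simp only: Lim_transform_eventually)
qed

section \<open>Exact variance and the critical limit along the equilibrium branch\<close>

theorem theorem6p1:
  fixes F :: "real^'n \<Rightarrow> real \<Rightarrow> real^'n"
    and B :: "real^'m^'n"
    and xs :: "real \<Rightarrow> real^'n" and x\<^sub>c :: "real^'n"
    and \<alpha>\<^sub>0 \<alpha>\<^sub>c :: real
    and lam\<^sub>1 :: "real \<Rightarrow> real"
    and v w :: "real \<Rightarrow> real^'n" and v\<^sub>c w\<^sub>c :: "real^'n"
    and C :: "real \<Rightarrow> real^'n^'n"
    and \<Omega> :: "real \<Rightarrow> 'a measure"
    and z :: "real \<Rightarrow> 'a \<Rightarrow> real^'n"
  assumes dim: "CARD('n) \<ge> 2"
    and branch_interval: "\<alpha>\<^sub>0 < \<alpha>\<^sub>c"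
    and smooth: "\<exists>U. C2_on (\<lambda>(x, \<alpha>). F x \<alpha>) U \<and>
                   (\<forall>\<alpha>\<in>{\<alpha>\<^sub>0<..<\<alpha>\<^sub>c}. (xs \<alpha>, \<alpha>) \<in> U) \<and> (x\<^sub>c, \<alpha>\<^sub>c) \<in> U"
    and equilibrium: "\<And>\<alpha>. \<alpha> \<in> {\<alpha>\<^sub>0<..<\<alpha>\<^sub>c} \<Longrightarrow> F (xs \<alpha>) \<alpha> = 0"
    and stable: "\<And>\<alpha>. \<alpha> \<in> {\<alpha>\<^sub>0<..<\<alpha>\<^sub>c} \<Longrightarrow> asymptotically_stable (\<lambda>x. F x \<alpha>) (xs \<alpha>)"
    and endpoint: "(xs \<longlongrightarrow> x\<^sub>c) (at_left \<alpha>\<^sub>c)"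
    and critical: "regular_critical_eigenvalue (linearization F xs) \<alpha>\<^sub>c lam\<^sub>1 v w v\<^sub>c w\<^sub>c"
    and covariance: "\<And>\<alpha>. \<alpha> \<in> {\<alpha>\<^sub>0<..<\<alpha>\<^sub>c} \<Longrightarrow>
                       stationary_covariance (linearization F xs \<alpha>) B (C \<alpha>)"
    and prob: "\<And>\<alpha>. \<alpha> \<in> {\<alpha>\<^sub>0<..<\<alpha>\<^sub>c} \<Longrightarrow> prob_space (\<Omega> \<alpha>)"
    and gaussian: "\<And>\<alpha>. \<alpha> \<in> {\<alpha>\<^sub>0<..<\<alpha>\<^sub>c} \<Longrightarrow> multivariate_normal (\<Omega> \<alpha>) (z \<alpha>) 0 (C \<alpha>)"
  shows "(\<forall>\<alpha>\<in>{\<alpha>\<^sub>0<..<\<alpha>\<^sub>c}.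
            prob_space.variance (\<Omega> \<alpha>) (\<lambda>\<omega>. V_fluc (z \<alpha> \<omega>)) =
              2 * trace ((centering :: real^'n^'n) ** C \<alpha> ** centering ** C \<alpha>)
                / (real CARD('n) - 1)\<^sup>2) \<and>
         (w\<^sub>c \<bullet> ((B ** transpose B) *v w\<^sub>c) > 0 \<and> (1 \<bullet> v\<^sub>c)\<^sup>2 / real CARD('n) < 1 \<longrightarrow>
            ((\<lambda>\<alpha>. sd (\<Omega> \<alpha>) (\<lambda>\<omega>. V_fluc (z \<alpha> \<omega>)) /
                   prob_space.expectation (\<Omega> \<alpha>) (\<lambda>\<omega>. V_fluc (z \<alpha> \<omega>)))
               \<longlongrightarrow> sqrt 2) (at_left \<alpha>\<^sub>c) \<and>
            ((\<lambda>\<alpha>. sd (\<Omega> \<alpha>) (\<lambda>\<omega>. spatial_variance (xs \<alpha> + z \<alpha> \<omega>)) /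
                   prob_space.expectation (\<Omega> \<alpha>) (\<lambda>\<omega>. spatial_variance (xs \<alpha> + z \<alpha> \<omega>)))
               \<longlongrightarrow> sqrt 2) (at_left \<alpha>\<^sub>c))"
proof (intro conjI impI ballI)
  fix \<alpha> assume \<alpha>: "\<alpha> \<in> {\<alpha>\<^sub>0<..<\<alpha>\<^sub>c}"
  interpret prob_space "\<Omega> \<alpha>" by (rule prob[OF \<alpha>])
  have "transpose (C \<alpha>) = C \<alpha>"
    using gaussian[OF \<alpha>] by (simp add: multivariate_normal_def)
  then show "variance (\<lambda>\<omega>. V_fluc (z \<alpha> \<omega>)) =
      2 * trace ((centering :: real^'n^'n) ** C \<alpha> ** centering ** C \<alpha>) / (real CARD('n) - 1)\<^sup>2"
    using spatial_variance_moments(2)[OF gaussian[OF \<alpha>], of 0]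
    by (simp add: V_fluc_eq_spatial_variance trace_centered_covariance)
next
  let ?M = "linearization F xs" and ?G = "at_left \<alpha>\<^sub>c" and ?Q = "B ** transpose B"
  assume "w\<^sub>c \<bullet> (?Q *v w\<^sub>c) > 0 \<and> (1 \<bullet> v\<^sub>c)\<^sup>2 / real CARD('n) < 1"
  then have noise: "w\<^sub>c \<bullet> (?Q *v w\<^sub>c) / 2 > 0" and nonuniform: "(1 \<bullet> v\<^sub>c)\<^sup>2 / real CARD('n) < 1"
    by auto
  have G: "?G \<noteq> bot" by simp
  have branch: "\<forall>\<^sub>F \<alpha> in ?G. \<alpha> \<in> {\<alpha>\<^sub>0<..<\<alpha>\<^sub>c}"
    using branch_interval by (rule eventually_at_left_real)

  obtain U where U: "C2_on (\<lambda>(x, \<alpha>). F x \<alpha>) U" "\<forall>\<alpha>\<in>{\<alpha>\<^sub>0<..<\<alpha>\<^sub>c}. (xs \<alpha>, \<alpha>) \<in> U" "(x\<^sub>c, \<alpha>\<^sub>c) \<in> U"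
    using smooth by blast
  have "\<forall>\<^sub>F \<alpha> in ?G. (xs \<alpha>, \<alpha>) \<in> U"
    using branch U(2) by (auto elim: eventually_mono)
  then obtain M\<^sub>c where M_lim: "(?M \<longlongrightarrow> M\<^sub>c) ?G"
    by (rule tendsto_linearization[OF U(1) _ U(3) endpoint])

  obtain \<delta> where "\<delta> > 0"
    and gap: "\<forall>\<^sub>F \<alpha> in ?G. \<forall>\<mu>. is_eigenvalue (?M \<alpha>) \<mu> \<and> \<mu> \<noteq> complex_of_real (lam\<^sub>1 \<alpha>) \<longrightarrow> \<delta> \<le> Re \<mu>"
    using critical unfolding regular_critical_eigenvalue_def by blast
  have spectrum: "\<forall>\<^sub>F \<alpha> in ?G. complex_diagonalizable (?M \<alpha>) \<and>
      simple_eigenvalue (?M \<alpha>) (complex_of_real (lam\<^sub>1 \<alpha>)) \<and> 0 < lam\<^sub>1 \<alpha>"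
    using critical unfolding regular_critical_eigenvalue_def by (auto elim: eventually_mono)
  have eigenvectors: "\<forall>\<^sub>F \<alpha> in ?G. ?M \<alpha> *v v \<alpha> = lam\<^sub>1 \<alpha> *\<^sub>R v \<alpha> \<and> w \<alpha> v* ?M \<alpha> = lam\<^sub>1 \<alpha> *\<^sub>R w \<alpha> \<and>
      norm (v \<alpha>) = 1 \<and> w \<alpha> \<bullet> v \<alpha> = 1"
    and lim: "(lam\<^sub>1 \<longlongrightarrow> 0) ?G" "(v \<longlongrightarrow> v\<^sub>c) ?G" "(w \<longlongrightarrow> w\<^sub>c) ?G"
    using critical unfolding regular_critical_eigenvalue_def by blast+

  have cov_lim: "((\<lambda>\<alpha>. lam\<^sub>1 \<alpha> *\<^sub>R C \<alpha>) \<longlongrightarrow> (w\<^sub>c \<bullet> (?Q *v w\<^sub>c) / 2) *\<^sub>R outer v\<^sub>c v\<^sub>c) ?G"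
  proof (rule lyapunov_solution_asymptotics[OF G \<open>\<delta> > 0\<close> _ _ _ M_lim lim])
    show "\<forall>\<^sub>F \<alpha> in ?G. complex_diagonalizable (?M \<alpha>) \<and> simple_eigenvalue (?M \<alpha>) (complex_of_real (lam\<^sub>1 \<alpha>)) \<and>
      0 < lam\<^sub>1 \<alpha> \<and> (\<forall>\<mu>. is_eigenvalue (?M \<alpha>) \<mu> \<and> \<mu> \<noteq> complex_of_real (lam\<^sub>1 \<alpha>) \<longrightarrow> \<delta> \<le> Re \<mu>)"
      using spectrum gap by eventually_elim blast
    show "\<forall>\<^sub>F \<alpha> in ?G. ?M \<alpha> *v v \<alpha> = lam\<^sub>1 \<alpha> *\<^sub>R v \<alpha> \<and> w \<alpha> v* ?M \<alpha> = lam\<^sub>1 \<alpha> *\<^sub>R w \<alpha> \<and> w \<alpha> \<bullet> v \<alpha> = 1"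
      using eigenvectors by eventually_elim blast
    \<comment> \<open>The symmetry of \<open>C \<alpha>\<close> comes from the Gaussian law, not
      from \<open>stationary_covariance\<close>.\<close>
    show "\<forall>\<^sub>F \<alpha> in ?G. ?M \<alpha> ** C \<alpha> + C \<alpha> ** transpose (?M \<alpha>) = ?Q \<and> transpose (C \<alpha>) = C \<alpha>"
      using branch
    proof eventually_elim
      case (elim \<alpha>)
      then show ?case
        using covariance[OF elim] gaussian[OF elim]
        by (simp add: stationary_covariance_def multivariate_normal_def)
    qed
  qed

  \<comment> \<open>The normalization passes to the limit, so the nonuniformity hypothesis says
    exactly that centering does not annihilate \<open>v\<^sub>c\<close>.\<close>
  have "((\<lambda>\<alpha>. norm (v \<alpha>)) \<longlongrightarrow> 1) ?G"
    by (rule Lim_transform_eventually[OF tendsto_const]) (use eigenvectors in eventually_elim, simp)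
  then have "norm v\<^sub>c = 1"
    using tendsto_unique[OF G tendsto_norm[OF lim(2)]] by blast
  then have "(norm (centering *v v\<^sub>c))\<^sup>2 = 1 - (1 \<bullet> v\<^sub>c)\<^sup>2 / real CARD('n)"
    by (simp add: norm_centering_mult_vec)
  then have v_c: "norm (centering *v v\<^sub>c) \<noteq> 0"
    using nonuniform by auto
  have prob_ev: "\<forall>\<^sub>F \<alpha> in ?G. prob_space (\<Omega> \<alpha>) \<and> multivariate_normal (\<Omega> \<alpha>) (z \<alpha>) 0 (C \<alpha>) \<and> 0 < lam\<^sub>1 \<alpha>"
    using branch spectrum by eventually_elim (use prob gaussian in blast)
  \<comment> \<open>The open premise is convergence of the location: constant 0 for the fluctuation
    part, \<open>xs\<close> for the full spatial variance.\<close>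
  note cv = spatial_variance_coefficient_of_variation[OF dim prob_ev lim(1) _ cov_lim noise v_c]
  show "((\<lambda>\<alpha>. sd (\<Omega> \<alpha>) (\<lambda>\<omega>. V_fluc (z \<alpha> \<omega>)) /
      prob_space.expectation (\<Omega> \<alpha>) (\<lambda>\<omega>. V_fluc (z \<alpha> \<omega>))) \<longlongrightarrow> sqrt 2) ?G"
    using cv[OF tendsto_const[of 0]] by (simp add: V_fluc_eq_spatial_variance)
  show "((\<lambda>\<alpha>. sd (\<Omega> \<alpha>) (\<lambda>\<omega>. spatial_variance (xs \<alpha> + z \<alpha> \<omega>)) /
      prob_space.expectation (\<Omega> \<alpha>) (\<lambda>\<omega>. spatial_variance (xs \<alpha> + z \<alpha> \<omega>))) \<longlongrightarrow> sqrt 2) ?G"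
    by (rule cv[OF endpoint])
qed

end
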